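(* Let $d\ge1$ and let $(U_n)_{n\ge0}$ be the infinite color urn model associated with the random walk on $S^d\subseteq\mathbb{R}^d$ with increments $\{X_i\}_{i\ge1}$. Let $\overline{\Lambda}_n$ be the probability measure on $\mathbb{R}^d$ corresponding to the probability vector $\frac{1}{n+1}\left(\mathbb{E}[U_{n,v}]\right)_{v\in S^d}$ and for $n\ge2$ let $$\overline{\Lambda}_n^{cs}(A):=\overline{\Lambda}_n\left(\sqrt{\log n}\,A\varSigma^{1/2}+\mu\log n\right),\qquad A\in\mathcal{B}(\mathbb{R}^d).$$ Then, as $n\to\infty$, $\overline{\Lambda}_n^{cs}\Rightarrow\Phi_d$.
   Context: Vectors are row vectors; $x^T$ denotes the transpose. $\{X_i\}_{i\ge1}$ are i.i.d. random vectors in $\mathbb{R}^d$ with finite non-empty support set $B\subseteq\mathbb{R}^d$ and probability mass function $p$. Let $$S^d:=\left\{\sum_{i=1}^kn_ib_i: k\ge1,\ n_1,\dots,n_k\in\{0,1,2,\dots\},\ b_1,\dots,b_k\in B\right\},$$ a countable subset of $\mathbb{R}^d$ which indexes the colors. Put $\mu:=\mathbb{E}[X_1]$ and $\varSigma:=\mathbb{E}[X_1^TX_1]$ (a non-centered second moment matrix), assumed positive definite; $\varSigma^{1/2}$ is its unique positive definite square root. Urn model: let $R=((p(v-u)))_{u,v\in S^d}$ and let $R_u$ be the $u$-th row of $R$. The initial configuration $U_0=(U_{0,v})_{v\in S^d}$ is a (non-random) probability vector with only finitely many non-zero entries. For $n\ge0$, the color $Z_n\in S^d$ of the $(n+1)$-th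 selected ball satisfies $\mathbb{P}(Z_n=v\mid U_n,\dots,U_0)=U_{n,v}/(n+1)$, $v\in S^d$, and $U_{n+1}=U_n+R_{Z_n}$, i.e. $U_{n+1,v}=U_{n,v}+p(v-Z_n)$. (So $\sum_vU_{n,v}=n+1$.) For a set $A\subseteq\mathbb{R}^d$, a matrix $M$, a scalar $c$ and a vector $b$, $cAM+b=\{c\,aM+b:a\in A\}$. $\mathcal{B}(\mathbb{R}^d)$ is the Borel $\sigma$-field, $\Phi_d$ the standard Gaussian measure on $\mathbb{R}^d$, and $\Rightarrow$ denotes weak convergence. *)

theory Defs
  imports "HOL-Probability.Probability"
begin

definition positive_definite :: "real^'d^'d \<Rightarrow> bool" where
  "positive_definite A \<longleftrightarrow> transpose A = A \<and> (\<forall>x. x \<noteq> 0 \<longrightarrow> x \<bullet> (A *v x) > 0)"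

text \<open>Meaningful only for positive definite \<open>A\<close>, where the square root exists and is unique.\<close>

definition matrix_sqrt :: "real^'d^'d \<Rightarrow> real^'d^'d" where
  "matrix_sqrt A = (THE T. positive_definite T \<and> T ** T = A)"

definition second_moment_matrix :: "'b measure \<Rightarrow> ('b \<Rightarrow> real^'d) \<Rightarrow> real^'d^'d" where
  "second_moment_matrix N Y =
     (\<integral>\<omega>. transpose (rowvector (Y \<omega>) :: real^'d^1) ** rowvector (Y \<omega>) \<partial>N)"

text \<open>The library's \<^const>\<open>weak_conv_m\<close> is restricted to measures on the real line.\<close>

definition weakly_converges ::
    "(nat \<Rightarrow> 'a::topological_space measure) \<Rightarrow> 'a measure \<Rightarrow> bool" where
  "weakly_converges L K \<longleftrightarrow>
     (\<forall>f :: 'a \<Rightarrow> real. continuous_on UNIV f \<and> bounded (range f) \<longrightarrow>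
        (\<lambda>n. \<integral>x. f x \<partial>(L n)) \<longlonglongrightarrow> (\<integral>x. f x \<partial>K))"

definition std_gaussian :: "(real^'d) measure" where
  "std_gaussian = density lborel (\<lambda>x. ennreal (\<Prod>i\<in>UNIV. std_normal_density (x $ i)))"

definition color_set :: "(real^'d) set \<Rightarrow> (real^'d) set" where
  "color_set B = {\<Sum>i=1..k. real (n i) *\<^sub>R b i | (k::nat) (n :: nat \<Rightarrow> nat) b.
                    k \<ge> 1 \<and> (\<forall>i\<in>{1..k}. b i \<in> B)}"

definition urn_history ::
    "'a measure \<Rightarrow> 'c set \<Rightarrow> (nat \<Rightarrow> 'a \<Rightarrow> 'c \<Rightarrow> real) \<Rightarrow> nat \<Rightarrow> 'a measure" where
  "urn_history M S U n = sigma (space M)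
     {(\<lambda>\<omega>. U k \<omega> v) -` A \<inter> space M | k v A. k \<le> n \<and> v \<in> S \<and> A \<in> sets borel}"

text \<open>
  \<open>U n \<omega> v\<close> is the entry of color \<open>v\<close> in the configuration at time \<open>n\<close>; only colors \<open>v\<close> in
  the color set matter, and nothing is assumed about \<open>U n \<omega> v\<close> for other \<open>v\<close>.
\<close>

locale infinite_color_urn = prob_space M
  for M :: "'a measure" +
  fixes p :: "(real^'d) pmf"
    and u0 :: "real^'d \<Rightarrow> real"
    and U :: "nat \<Rightarrow> 'a \<Rightarrow> real^'d \<Rightarrow> real"
    and Z :: "nat \<Rightarrow> 'a \<Rightarrow> real^'d"
  assumes u0_nonneg: "v \<in> color_set (set_pmf p) \<Longrightarrow> u0 v \<ge> 0"
    and u0_finite_support: "finite {v \<in> color_set (set_pmf p). u0 v \<noteq> 0}"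
    and u0_sum: "(\<Sum>v | v \<in> color_set (set_pmf p) \<and> u0 v \<noteq> 0. u0 v) = 1"
    and U_measurable:
      "v \<in> color_set (set_pmf p) \<Longrightarrow> (\<lambda>\<omega>. U n \<omega> v) \<in> borel_measurable M"
    and Z_measurable: "Z n \<in> M \<rightarrow>\<^sub>M count_space (color_set (set_pmf p))"
    and U_0: "\<omega> \<in> space M \<Longrightarrow> v \<in> color_set (set_pmf p) \<Longrightarrow> U 0 \<omega> v = u0 v"
    and U_Suc: "\<omega> \<in> space M \<Longrightarrow> v \<in> color_set (set_pmf p) \<Longrightarrow>
      U (Suc n) \<omega> v = U n \<omega> v + pmf p (v - Z n \<omega>)"
    and Z_cond: "v \<in> color_set (set_pmf p) \<Longrightarrow>
      AE \<omega> in M. real_cond_exp M (urn_history M (color_set (set_pmf p)) U n)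
        (indicator {\<omega>' \<in> space M. Z n \<omega>' = v}) \<omega> = U n \<omega> v / (real n + 1)"

definition mean_color_law ::
    "'a measure \<Rightarrow> (real^'d) set \<Rightarrow> (nat \<Rightarrow> 'a \<Rightarrow> real^'d \<Rightarrow> real) \<Rightarrow> nat \<Rightarrow> (real^'d) measure" where
  "mean_color_law M S U n =
     distr (point_measure S (\<lambda>v. ennreal ((\<integral>\<omega>. U n \<omega> v \<partial>M) / (real n + 1)))) borel (\<lambda>v. v)"

text \<open>
  For \<open>n \<ge> 2\<close> and invertible \<open>T\<close> the set function below is a Borel measure, so it is the
  \<^const>\<open>emeasure\<close> of the result. For \<open>n < 2\<close> (where \<open>ln n = 0\<close>) the value is irrelevant.
\<close>

definition centered_scaled ::
    "(real^'d) measure \<Rightarrow> real^'d \<Rightarrow> real^'d^'d \<Rightarrow> nat \<Rightarrow> (real^'d) measure" where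
  "centered_scaled L m T n = measure_of UNIV (sets borel)
     (\<lambda>A. emeasure L ((\<lambda>a. sqrt (ln (real n)) *\<^sub>R (a v* T) + ln (real n) *\<^sub>R m) ` A))"

end

theory Submission
  imports Defs "HOL-Real_Asymp.Real_Asymp"
begin

text \<open>The mean color distribution obeys a linear recursion. Taking expectations in
  \<open>U (Suc n) v = U n v + p (v - Z n)\<close> and using that \<open>Z n\<close> has the point probabilities
  \<open>E (U n v) / (n + 1)\<close> gives, for the characteristic function \<open>\<phi> n\<close> of the mean color
  distribution and the characteristic function \<open>\<psi>\<close> of one increment,
  \<open>\<phi> n t = \<phi> 0 t * (\<Prod>k<n. 1 + (\<psi> t - 1) / (k + 2))\<close> (\<open>mean_char_prod\<close>). So the mean color
  distribution is that of an initial color plus a random walk that takes a step at time \<open>k\<close> with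
  probability \<open>1 / (k + 2)\<close>, hence about \<open>ln n\<close> steps in all. The number of
  steps has both mean and variance close to \<open>ln n\<close>, like a Poisson variable, which is why the
  second moment matrix, and not the covariance matrix, normalizes the limit: for small
  \<open>w = \<psi> t - 1\<close> the product is \<open>exp (w * ln n)\<close> up to a
  vanishing error, and \<open>w * ln n\<close> at \<open>t = s / sqrt (ln n)\<close> equals
  \<open>\<i> * sqrt (ln n) * (s \<bullet> \<mu>) - s \<bullet> (\<Sigma> *v s) / 2\<close> plus a vanishing error. Centering removes
  the first term, and \<open>\<Sigma> = T ** T\<close> turns the second one into the Gaussian exponent
  (\<open>harmonic_product_char_limit\<close>).

  Two general facts complete the argument. Pointwise convergence of characteristic functions to
  that of a probability measure implies weak convergence on a Euclidean space
  (\<open>levy_continuity_euclidean\<close>); here tightness comes from Levy's theorem on the line, applied to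
  the coordinates, and trigonometric polynomials are dense in a sense that is uniform on compact
  sets and bounded outside them. A positive definite matrix has exactly one positive definite
  square root (\<open>matrix_sqrt_positive_definite\<close>); it is constructed as a fixed point of a
  contraction, which also yields the commutation property behind uniqueness.\<close>

section \<open>Weak convergence from characteristic functions on a Euclidean space\<close>

text \<open>A single generator with a phase shift covers cosines, sines and constants, and the product-to-sum
  formula keeps products of generators inside the class.\<close>

inductive trig_poly :: "('a::euclidean_space \<Rightarrow> real) \<Rightarrow> bool" where
  wave: "trig_poly (\<lambda>x. a * cos (t \<bullet> x + s))"
| add: "trig_poly f \<Longrightarrow> trig_poly g \<Longrightarrow> trig_poly (\<lambda>x. f x + g x)"

lemma trig_poly_const: "trig_poly (\<lambda>_. c)"
  using trig_poly.wave[of c 0 0] by simp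

lemma trig_poly_mult_wave:
  assumes "trig_poly f"
  shows "trig_poly (\<lambda>x. f x * (b * cos (u \<bullet> x + r)))"
  using assms
proof induction
  case (wave a t s)
  have eq: "(\<lambda>x. a * cos (t \<bullet> x + s) * (b * cos (u \<bullet> x + r))) =
        (\<lambda>x. (a * b / 2) * cos ((t - u) \<bullet> x + (s - r)) + (a * b / 2) * cos ((t + u) \<bullet> x + (s + r)))"
  proof
    fix x
    show "a * cos (t \<bullet> x + s) * (b * cos (u \<bullet> x + r)) = 
      (a * b / 2) * cos ((t - u) \<bullet> x + (s - r)) + (a * b / 2) * cos ((t + u) \<bullet> x + (s + r))"
      using cos_times_cos[of "t \<bullet> x + s" "u \<bullet> x + r"]
      by (simp add: inner_diff_left inner_add_left algebra_simps add_divide_distrib)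
  qed
  show ?case
    unfolding eq by (intro trig_poly.add trig_poly.wave)
next
  case (add h k)
  show ?case
    unfolding distrib_right by (rule trig_poly.add[OF add.IH])
qed

lemma trig_poly_mult:
  assumes "trig_poly f" "trig_poly g"
  shows "trig_poly (\<lambda>x. f x * g x)"
  using assms(2)
proof induction
  case (wave a t s)
  show ?case by (rule trig_poly_mult_wave[OF assms(1)])
next
  case (add h k)
  show ?case
    unfolding distrib_left by (rule trig_poly.add[OF add.IH])
qed

lemma trig_poly_polynomial_compose:
  fixes q :: "real \<Rightarrow> real"
  assumes "real_polynomial_function q" "trig_poly f"
  shows "trig_poly (\<lambda>x. q (f x))"
  using assms(1)
proof induction
  case (linear q)
  have "q (f x) = q 1 * f x" for x
    using linear_cmul[OF bounded_linear.linear[OF linear], of "f x" 1] by simp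
  then show ?case using trig_poly_mult[OF trig_poly_const assms(2), of "q 1"] by simp
next
  case (const c)
  show ?case by (rule trig_poly_const)
next
  case (add p q)
  show ?case by (rule trig_poly.add[OF add.IH])
next
  case (mult p q)
  show ?case by (rule trig_poly_mult[OF mult.IH])
qed

lemma trig_poly_continuous: "trig_poly f \<Longrightarrow> continuous_on S f"
  by (induction rule: trig_poly.induct) (auto intro!: continuous_intros)

lemma trig_poly_bounded: "trig_poly f \<Longrightarrow> \<exists>C. \<forall>x. \<bar>f x\<bar> \<le> C"
proof (induction rule: trig_poly.induct)
  case (wave a t s)
  have "\<bar>a * cos (t \<bullet> x + s)\<bar> \<le> \<bar>a\<bar>" for x
    by (simp add: abs_mult mult_left_le)
  then show ?case by blast
next
  case (add f g)
  then obtain C D where "\<And>x. \<bar>f x\<bar> \<le> C" "\<And>x. \<bar>g x\<bar> \<le> D" by blast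
  then have "\<bar>f x + g x\<bar> \<le> C + D" for x
    using abs_triangle_ineq[of "f x" "g x"] by (smt (verit))
  then show ?case by blast
qed

lemma trig_poly_separates:
  fixes x y :: "'a::euclidean_space"
  assumes "x \<noteq> y"
  shows "\<exists>f. trig_poly f \<and> f x \<noteq> f y"
proof -
  define t where "t = (1 / norm (x - y) ^ 2) *\<^sub>R (x - y)"
  have *: "t \<bullet> (x - y) = 1"
    using assms by (simp add: t_def power2_norm_eq_inner)
  have "trig_poly (\<lambda>z. 1 * cos (t \<bullet> z + (- (t \<bullet> y))))"
    by (rule trig_poly.wave)
  moreover have "cos (1::real) \<noteq> 1"
    using cos_monotone_0_pi[of 0 1] pi_gt3 by simp
  then have "1 * cos (t \<bullet> x + (- (t \<bullet> y))) \<noteq> 1 * cos (t \<bullet> y + (- (t \<bullet> y)))"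
    using * by (simp add: inner_diff_right)
  ultimately show ?thesis by blast
qed

text \<open>Stone--Weierstrass alone gives an approximation on the compact set with no control outside it.
  Composing that approximation with a polynomial that is close to the truncation of the real line to
  \<open>[-B, B]\<close> on its (bounded) range stays inside the algebra of trigonometric polynomials and
  restores the global bound.\<close>

lemma trig_poly_approx:
  fixes f :: "'a::euclidean_space \<Rightarrow> real"
  assumes f: "continuous_on UNIV f" and B: "\<And>x. \<bar>f x\<bar> \<le> B" and S: "compact S" and e: "e > 0"
  obtains P where "trig_poly P" "\<And>x. x \<in> S \<Longrightarrow> \<bar>f x - P x\<bar> \<le> e" "\<And>x. \<bar>P x\<bar> \<le> B + e"
proof -
  interpret function_ring_on "Collect trig_poly" S
  proof
    show "\<exists>f\<in>Collect trig_poly. f x \<noteq> f y" if "x \<noteq> y" for x y :: 'a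
      using trig_poly_separates[OF that] by blast
  qed (simp_all add: S trig_poly_continuous trig_poly.add trig_poly_mult trig_poly_const)
  obtain Q where Q: "trig_poly Q" "\<And>x. x \<in> S \<Longrightarrow> \<bar>f x - Q x\<bar> < e / 2"
    using Stone_Weierstrass_basic[OF continuous_on_subset[OF f subset_UNIV], of "e/2"] e by auto
  obtain m where m: "\<And>x. \<bar>Q x\<bar> \<le> m"
    using trig_poly_bounded[OF Q(1)] by blast
  define clamp where "clamp y = max (- B) (min B y)" for y
  have B0: "0 \<le> B" using B[of undefined] by linarith
  \<comment> \<open>\<open>clamp\<close> fixes the values of \<open>f\<close> and is 1-Lipschitz, so it does not spoil the approximation.\<close>
  have "continuous_on {-m..m} clamp"
    unfolding clamp_def by (intro continuous_intros)
  then obtain q where q: "real_polynomial_function q" "\<And>y. y \<in> {-m..m} \<Longrightarrow> \<bar>clamp y - q y\<bar> < e / 2"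
    using Stone_Weierstrass_real_polynomial_function[of "{-m..m}" clamp "e/2"] e by auto
  show ?thesis
  proof
    show "trig_poly (\<lambda>x. q (Q x))"
      by (rule trig_poly_polynomial_compose[OF q(1) Q(1)])
    have near: "\<bar>clamp (Q x) - q (Q x)\<bar> < e / 2" for x
      using q(2)[of "Q x"] m[of x] by (simp add: abs_le_iff minus_le_iff)
    show "\<bar>q (Q x)\<bar> \<le> B + e" for x
    proof -
      have "\<bar>clamp (Q x)\<bar> \<le> B" using B0 unfolding clamp_def by (auto simp: max_def min_def)
      then show ?thesis using near[of x] e by linarith
    qed
    show "\<bar>f x - q (Q x)\<bar> \<le> e" if "x \<in> S" for x
    proof -
      have "\<bar>f x - clamp (Q x)\<bar> \<le> \<bar>f x - Q x\<bar>"
        using B[of x] unfolding clamp_def by (auto simp: max_def min_def)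
      then show ?thesis using near[of x] Q(2)[OF that] by linarith
    qed
  qed
qed

lemma integrable_continuous_bounded:
  fixes f :: "'a::topological_space \<Rightarrow> 'b::{banach,second_countable_topology}"
  assumes "prob_space M" "sets M = sets borel" "continuous_on UNIV f" "\<And>x. norm (f x) \<le> C"
  shows "integrable M f"
proof -
  interpret prob_space M by fact
  show ?thesis
  proof (rule integrable_const_bound[of _ C])
    show "f \<in> borel_measurable M"
      unfolding measurable_cong_sets[OF assms(2) refl]
      by (rule borel_measurable_continuous_onI[OF assms(3)])
  qed (use assms(4) in simp)
qed

lemma trig_poly_integral_tendsto:
  fixes L :: "nat \<Rightarrow> 'a::euclidean_space measure"
  assumes L: "\<And>n. prob_space (L n)" "\<And>n. sets (L n) = sets borel"
    and K: "prob_space K" "sets K = sets borel"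
    and conv: "\<And>t. (\<lambda>n. \<integral>x. iexp (t \<bullet> x) \<partial>L n) \<longlonglongrightarrow> (\<integral>x. iexp (t \<bullet> x) \<partial>K)"
    and P: "trig_poly P"
  shows "(\<lambda>n. \<integral>x. P x \<partial>L n) \<longlonglongrightarrow> (\<integral>x. P x \<partial>K)"
  using P
proof induction
  case (wave a t s)
  have eq: "(\<integral>x. a * cos (t \<bullet> x + s) \<partial>N) = a * Re (iexp s * (\<integral>x. iexp (t \<bullet> x) \<partial>N))"
    if "prob_space N" "sets N = sets borel" for N
  proof -
    interpret prob_space N by fact
    have int: "integrable N (\<lambda>x. iexp (t \<bullet> x))"
      by (rule integrable_continuous_bounded[where C=1]) (auto intro!: continuous_intros that)
    have "a * Re (iexp s * (\<integral>x. iexp (t \<bullet> x) \<partial>N)) = Re (\<integral>x. of_real a * (iexp s * iexp (t \<bullet> x)) \<partial>N)"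
      using int by simp
    also have "\<dots> = (\<integral>x. Re (of_real a * (iexp s * iexp (t \<bullet> x))) \<partial>N)"
      by (rule integral_Re[symmetric]) (intro integrable_mult_right int)
    also have "\<dots> = (\<integral>x. a * cos (t \<bullet> x + s) \<partial>N)"
      by (intro Bochner_Integration.integral_cong refl)
         (simp add: exp_add[symmetric] distrib_left[symmetric] of_real_add[symmetric]
            Re_exp add.commute del: of_real_add)
    finally show ?thesis ..
  qed
  show ?case
    unfolding eq[OF L] eq[OF K] by (intro tendsto_intros conv)
next
  case (add f g)
  have int: "integrable N f" if N: "prob_space N" "sets N = sets borel" and f: "trig_poly f" for N and f :: "'a \<Rightarrow> real"
  proof -
    interpret prob_space N by fact
    obtain C where "\<And>x. \<bar>f x\<bar> \<le> C" using trig_poly_bounded[OF f] by blast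
    then show ?thesis
      using integrable_continuous_bounded[OF N trig_poly_continuous[OF f], of C] by simp
  qed
  show ?case
    using add.IH by (simp add: int[OF L] int[OF K] add.hyps tendsto_add)
qed

text \<open>A continuous substitute for the indicator of \<open>\<bar>y\<bar> \<ge> R + 1\<close>: it dominates that indicator and
  vanishes for \<open>\<bar>y\<bar> \<le> R\<close>, so that tails are controlled by integrals of bounded continuous
  functions.\<close>

definition ramp :: "real \<Rightarrow> real \<Rightarrow> real" where
  "ramp R y = min 1 (max 0 (\<bar>y\<bar> - R))"

text \<open>The one-dimensional continuity theorem applies to the image measures under \<open>x \<mapsto> b \<bullet> x\<close>, whose
  characteristic functions are the given ones along the line through \<open>b\<close>.\<close>

lemma ramp_integral_tendsto:
  fixes L :: "nat \<Rightarrow> 'a::euclidean_space measure"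
  assumes L: "\<And>n. prob_space (L n)" "\<And>n. sets (L n) = sets borel"
    and K: "prob_space K" "sets K = sets borel"
    and conv: "\<And>t. (\<lambda>n. \<integral>x. iexp (t \<bullet> x) \<partial>L n) \<longlonglongrightarrow> (\<integral>x. iexp (t \<bullet> x) \<partial>K)"
  shows "(\<lambda>n. \<integral>x. ramp R (b \<bullet> x) \<partial>L n) \<longlonglongrightarrow> (\<integral>x. ramp R (b \<bullet> x) \<partial>K)"
proof -
  have meas: "(\<lambda>x. b \<bullet> x) \<in> borel_measurable N" if "sets N = sets borel" for N :: "'a measure"
    unfolding measurable_cong_sets[OF that refl] by simp
  have rd: "real_distribution (distr N borel (\<lambda>x. b \<bullet> x))" if "prob_space N" "sets N = sets borel" for N
    using that by (intro prob_space.real_distribution_distr meas) auto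
  have ch: "char (distr N borel (\<lambda>x. b \<bullet> x)) s = (\<integral>x. iexp ((s *\<^sub>R b) \<bullet> x) \<partial>N)" if "sets N = sets borel" for N s
    unfolding char_def by (subst integral_distr[OF meas[OF that]]) simp_all
  have wc: "weak_conv_m (\<lambda>n. distr (L n) borel (\<lambda>x. b \<bullet> x)) (distr K borel (\<lambda>x. b \<bullet> x))"
    by (rule levy_continuity) (auto simp only: ch[OF L(2)] ch[OF K(2)] intro!: rd L K conv)
  have "(\<lambda>n. \<integral>y. ramp R y \<partial>distr (L n) borel (\<lambda>x. b \<bullet> x)) \<longlonglongrightarrow> (\<integral>y. ramp R y \<partial>distr K borel (\<lambda>x. b \<bullet> x))"
  proof (rule weak_conv_imp_integral_bdd_continuous_conv[where B=1])
    show "real_distribution (distr (L n) borel ((\<bullet>) b))" for n by (rule rd[OF L])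
    show "real_distribution (distr K borel ((\<bullet>) b))" by (rule rd[OF K])
    show "weak_conv_m (\<lambda>n. distr (L n) borel ((\<bullet>) b)) (distr K borel ((\<bullet>) b))" by (rule wc)
    show "isCont (ramp R) x" for x unfolding ramp_def by (intro continuous_intros)
    show "norm (ramp R x) \<le> 1" for x unfolding ramp_def by auto
  qed
  moreover have "ramp R \<in> borel_measurable borel" unfolding ramp_def by measurable
  ultimately show ?thesis by (simp add: integral_distr meas L K)
qed

lemma ramp_integral_vanishes:
  fixes K :: "'a::euclidean_space measure"
  assumes K: "prob_space K" "sets K = sets borel"
  shows "(\<lambda>k. \<integral>x. ramp (real k) (b \<bullet> x) \<partial>K) \<longlonglongrightarrow> 0"
proof -
  interpret prob_space K by fact
  have meas: "(\<lambda>x. b \<bullet> x) \<in> borel_measurable K"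
    unfolding measurable_cong_sets[OF K(2) refl] by simp
  have "(\<lambda>k. \<integral>x. ramp (real k) (b \<bullet> x) \<partial>K) \<longlonglongrightarrow> (\<integral>x. 0 \<partial>K)"
  proof (rule integral_dominated_convergence[where w="\<lambda>_. 1"])
    show "AE x in K. (\<lambda>k. ramp (real k) (b \<bullet> x)) \<longlonglongrightarrow> 0"
    proof (rule AE_I2)
      fix x
      have "\<forall>\<^sub>F k in sequentially. ramp (real k) (b \<bullet> x) = 0"
        using eventually_ge_at_top[of "nat \<lceil>\<bar>b \<bullet> x\<bar>\<rceil>"]
        by eventually_elim (auto simp: ramp_def)
      then show "(\<lambda>k. ramp (real k) (b \<bullet> x)) \<longlonglongrightarrow> 0"
        by (rule tendsto_eventually)
    qed
    show "(\<lambda>x. ramp (real k) (b \<bullet> x)) \<in> borel_measurable K" for k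
      unfolding ramp_def using meas by measurable
  qed (auto simp: ramp_def)
  then show ?thesis by simp
qed

text \<open>A bounded continuous \<open>f\<close> differs from a trigonometric polynomial by at most a small constant
  inside a large cube, and by a bounded amount outside it. The sum \<open>G\<close> of the coordinate ramps is at
  least one outside the cube, so its integrals bound the second error; these integrals converge, and
  their limit is small because a single probability measure is tight.\<close>

theorem levy_continuity_euclidean:
  fixes L :: "nat \<Rightarrow> 'a::euclidean_space measure"
  assumes L: "\<And>n. prob_space (L n)" "\<And>n. sets (L n) = sets borel"
    and K: "prob_space K" "sets K = sets borel"
    and conv: "\<And>t. (\<lambda>n. \<integral>x. iexp (t \<bullet> x) \<partial>L n) \<longlonglongrightarrow> (\<integral>x. iexp (t \<bullet> x) \<partial>K)"
  shows "weakly_converges L K"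
  unfolding weakly_converges_def
proof (intro allI impI, elim conjE)
  fix f :: "'a \<Rightarrow> real"
  assume f: "continuous_on UNIV f" and "bounded (range f)"
  then obtain B where B: "\<And>x. \<bar>f x\<bar> \<le> B" by (auto simp: bounded_iff)
  have B0: "0 \<le> B" using B[of undefined] by linarith
  define G where "G R x = (\<Sum>b\<in>Basis. ramp R (b \<bullet> x))" for R and x :: 'a
  have G_cont: "continuous_on UNIV (G R)" for R
    unfolding G_def ramp_def by (intro continuous_intros)
  have G_nonneg: "0 \<le> G R x" for R x
    unfolding G_def ramp_def by (intro sum_nonneg) auto
  have G_bound: "norm (G R x) \<le> real DIM('a)" for R x
    using G_nonneg[of R x] sum_bounded_above[of Basis "\<lambda>b. ramp R (b \<bullet> x)" 1]
    by (simp add: G_def ramp_def)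
  have G_outside: "1 \<le> G R x" if out: "x \<notin> cbox (\<Sum>b\<in>Basis. - (R + 1) *\<^sub>R b) (\<Sum>b\<in>Basis. (R + 1) *\<^sub>R b)" for R x
  proof -
    obtain b where b: "b \<in> Basis" "\<bar>b \<bullet> x\<bar> > R + 1"
      using out by (auto simp: mem_box inner_commute[of x] abs_less_iff not_le minus_less_iff)
    have "1 = ramp R (b \<bullet> x)" using b(2) by (simp add: ramp_def)
    also have "\<dots> \<le> G R x" unfolding G_def
      by (rule member_le_sum) (use b in \<open>auto simp: ramp_def\<close>)
    finally show ?thesis .
  qed
  have ramp_int: "integrable N (\<lambda>x. ramp R (b \<bullet> x))" if "prob_space N" "sets N = sets borel" for N R and b :: 'a
  proof -
    interpret prob_space N by fact
    show ?thesis
      by (rule integrable_continuous_bounded[where C=1])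
         (use that in \<open>auto simp: ramp_def intro!: continuous_intros\<close>)
  qed
  have G_int: "integrable N (G R)" if "prob_space N" "sets N = sets borel" for N R
    unfolding G_def by (intro Bochner_Integration.integrable_sum ramp_int that)
  have G_integral: "(\<integral>x. G R x \<partial>N) = (\<Sum>b\<in>Basis. \<integral>x. ramp R (b \<bullet> x) \<partial>N)" if "prob_space N" "sets N = sets borel" for N R
    unfolding G_def by (intro Bochner_Integration.integral_sum ramp_int that)
  have G_lim: "(\<lambda>n. \<integral>x. G R x \<partial>L n) \<longlonglongrightarrow> (\<integral>x. G R x \<partial>K)" for R
    unfolding G_integral[OF L] G_integral[OF K]
    by (intro tendsto_sum ramp_integral_tendsto L K conv)
  have G_small: "(\<lambda>k. \<integral>x. G (real k) x \<partial>K) \<longlonglongrightarrow> 0"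
    unfolding G_integral[OF K] by (intro tendsto_null_sum ramp_integral_vanishes K)
  show "(\<lambda>n. \<integral>x. f x \<partial>L n) \<longlonglongrightarrow> (\<integral>x. f x \<partial>K)"
  proof (rule tendstoI)
    fix e :: real assume e: "e > 0"
    \<comment> \<open>The total error below is \<open>2 * (d + (2 * B + 1) * d) + d = d * (4 * B + 5)\<close>.\<close>
    define d where "d = min 1 (e / (4 * B + 8))"
    have d: "0 < d" "d \<le> 1" and "d \<le> e / (4 * B + 8)"
      using e B0 by (auto simp: d_def)
    then have d3: "d * (4 * B + 8) \<le> e"
      using B0 by (subst (asm) pos_le_divide_eq) auto
    obtain k where k: "(\<integral>x. G (real k) x \<partial>K) < d"
      using order_tendstoD(2)[OF G_small d(1)] by (auto simp: eventually_sequentially)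
    obtain P where P: "trig_poly P"
      "\<And>x. x \<in> cbox (\<Sum>b\<in>Basis. - (real k + 1) *\<^sub>R b) (\<Sum>b\<in>Basis. (real k + 1) *\<^sub>R b) \<Longrightarrow> \<bar>f x - P x\<bar> \<le> d" 
      "\<And>x. \<bar>P x\<bar> \<le> B + d"
      using trig_poly_approx[OF f B compact_cbox d(1)] by metis
    have pointwise: "\<bar>f x - P x\<bar> \<le> d + (2 * B + 1) * G (real k) x" for x
    proof (cases "x \<in> cbox (\<Sum>b\<in>Basis. - (real k + 1) *\<^sub>R b) (\<Sum>b\<in>Basis. (real k + 1) *\<^sub>R b)")
      case True
      have "0 \<le> (2 * B + 1) * G (real k) x" using B0 G_nonneg by simp
      then show ?thesis using P(2)[OF True] by linarith
    next
      case False
      have "\<bar>f x - P x\<bar> \<le> \<bar>f x\<bar> + \<bar>P x\<bar>" by (rule abs_triangle_ineq4)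
      also have "\<dots> \<le> B + (B + d)" using B P(3) by (rule add_mono)
      also have "\<dots> \<le> d + (2 * B + 1) * 1" by simp
      also have "\<dots> \<le> d + (2 * B + 1) * G (real k) x"
        using G_outside[OF False] B0 by (intro add_left_mono mult_left_mono) auto
      finally show ?thesis .
    qed
    have close: "\<bar>(\<integral>x. f x \<partial>N) - (\<integral>x. P x \<partial>N)\<bar> \<le> d + (2 * B + 1) * (\<integral>x. G (real k) x \<partial>N)"
      if N: "prob_space N" "sets N = sets borel" for N
    proof -
      interpret prob_space N by fact
      have fi: "integrable N f" by (rule integrable_continuous_bounded[OF N f, of B]) (simp add: B)
      have Pi: "integrable N P" 
        by (rule integrable_continuous_bounded[OF N trig_poly_continuous[OF P(1)], of "B + d"]) (simp add: P)
      have "\<bar>(\<integral>x. f x \<partial>N) - (\<integral>x. P x \<partial>N)\<bar> = \<bar>\<integral>x. f x - P x \<partial>N\<bar>" by (simp add: fi Pi)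
      also have "\<dots> \<le> (\<integral>x. \<bar>f x - P x\<bar> \<partial>N)" by (rule integral_abs_bound)
      also have "\<dots> \<le> (\<integral>x. d + (2 * B + 1) * G (real k) x \<partial>N)"
        by (intro integral_mono pointwise) (auto intro!: fi Pi G_int[OF N])
      also have "\<dots> = d + (2 * B + 1) * (\<integral>x. G (real k) x \<partial>N)"
        using G_int[OF N] by (simp add: prob_space)
      finally show ?thesis .
    qed
    have triangle: "\<bar>a - b\<bar> < 2 * (d + z) + d"
      if "\<bar>a - p\<bar> \<le> d + x" "\<bar>b - q\<bar> \<le> d + y" "x \<le> z" "y \<le> z" "\<bar>p - q\<bar> < d" for a b p q x y z :: real
      using that by (smt (verit))
    have "\<forall>\<^sub>F n in sequentially. (\<integral>x. G (real k) x \<partial>L n) < d"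
      by (rule order_tendstoD(2)[OF G_lim k])
    moreover have "\<forall>\<^sub>F n in sequentially. dist (\<integral>x. P x \<partial>L n) (\<integral>x. P x \<partial>K) < d"
      by (rule tendstoD[OF trig_poly_integral_tendsto[OF L K conv P(1)] d(1)])
    ultimately show "\<forall>\<^sub>F n in sequentially. dist (\<integral>x. f x \<partial>L n) (\<integral>x. f x \<partial>K) < e"
    proof eventually_elim
      case (elim n)
      have *: "(2 * B + 1) * (\<integral>x. G (real k) x \<partial>N) \<le> (2 * B + 1) * d" if "(\<integral>x. G (real k) x \<partial>N) < d" for N
        using that B0 by (intro mult_left_mono) auto
      have "\<bar>(\<integral>x. f x \<partial>L n) - (\<integral>x. f x \<partial>K)\<bar> < 2 * (d + (2 * B + 1) * d) + d"
        by (rule triangle[OF close[OF L] close[OF K] *[OF elim(1)] *[OF k]])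
           (use elim(2) in \<open>simp add: dist_real_def\<close>)
      also have "\<dots> \<le> e" using d d3 by (simp add: algebra_simps)
      finally show ?case by (simp add: dist_real_def)
    qed
  qed
qed

section \<open>The standard Gaussian measure\<close>

text \<open>Lebesgue measure is the product of its coordinates along the standard basis, so integrals of
  products of one-coordinate functions factor. The function \<open>h\<close> in the proof reindexes the factors
  from indices \<open>i\<close> to basis vectors \<open>axis i 1\<close>.\<close>

lemma std_gaussian_integral_prod:
  fixes g :: "'d::finite \<Rightarrow> real \<Rightarrow> complex"
  assumes [measurable]: "\<And>i. g i \<in> borel_measurable borel" 
    and int: "\<And>i. integrable std_normal_distribution (g i)"
  shows "(\<integral>x. (\<Prod>i\<in>UNIV. g i (x $ i)) \<partial>(std_gaussian :: (real^'d) measure)) =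
    (\<Prod>i\<in>UNIV. \<integral>y. g i y \<partial>std_normal_distribution)"
proof -
  interpret product_sigma_finite "\<lambda>_::real^'d. lborel :: real measure" ..
  define h where "h b y = std_normal_density y *\<^sub>R g (THE i. b = axis i 1) y" for b :: "real^'d" and y
  have h: "h (axis i 1) y = std_normal_density y *\<^sub>R g i y" for i y
    unfolding h_def by (simp add: axis_eq_axis)
  have inj: "inj (\<lambda>i::'d. axis i (1::real))" by (auto simp: inj_on_def axis_eq_axis)
  have Basis: "(Basis :: (real^'d) set) = range (\<lambda>i. axis i 1)" by (auto simp: Basis_vec_def)
  have "(\<integral>x. (\<Prod>i\<in>UNIV. g i (x $ i)) \<partial>(std_gaussian :: (real^'d) measure)) =
      (\<integral>x. (\<Prod>i\<in>UNIV. std_normal_density (x $ i)) *\<^sub>R (\<Prod>i\<in>UNIV. g i (x $ i)) \<partial>(lborel :: (real^'d) measure))"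
    unfolding std_gaussian_def by (rule integral_density) (auto intro!: prod_nonneg)
  also have "\<dots> = (\<integral>x. (\<Prod>b\<in>Basis. h b (x \<bullet> b)) \<partial>(lborel :: (real^'d) measure))"
    unfolding Basis by (subst prod.reindex[OF inj]) (simp add: h inner_axis scaleR_conv_of_real prod.distrib)
  also have "\<dots> = (\<integral>x. (\<Prod>b\<in>Basis. h b (x b)) \<partial>(\<Pi>\<^sub>M b\<in>(Basis::(real^'d) set). lborel))"
  proof (subst lborel_eq, subst integral_distr)
    show "(\<lambda>x::real^'d. \<Prod>b\<in>Basis. h b (x \<bullet> b)) \<in> borel_measurable borel"
      unfolding h_def by measurable
  qed (auto intro!: Bochner_Integration.integral_cong prod.cong simp: inner_sum_left inner_Basis if_distrib sum.delta cong: if_cong)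
  also have "\<dots> = (\<Prod>b\<in>Basis. \<integral>y. h b y \<partial>lborel)"
  proof (rule product_integral_prod)
    fix b :: "real^'d" assume "b \<in> Basis"
    then obtain i where "b = axis i 1" by (auto simp: Basis)
    then show "integrable lborel (h b)"
      using int[of i] by (simp add: h[abs_def] integrable_density)
  qed simp
  also have "\<dots> = (\<Prod>i\<in>UNIV. \<integral>y. g i y \<partial>std_normal_distribution)"
    unfolding Basis by (subst prod.reindex[OF inj]) (simp add: h[abs_def] integral_density)
  finally show ?thesis .
qed

lemma prob_space_std_gaussian: "prob_space (std_gaussian :: (real^'d) measure)"
proof
  have inj: "inj (\<lambda>i::'d. axis i (1::real))" by (auto simp: inj_on_def axis_eq_axis)
  have Basis: "(Basis :: (real^'d) set) = range (\<lambda>i. axis i 1)" by (auto simp: Basis_vec_def)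
  have "emeasure (std_gaussian :: (real^'d) measure) (space std_gaussian) =
      (\<integral>\<^sup>+x. (\<Prod>b\<in>Basis. ennreal (std_normal_density (x \<bullet> b))) \<partial>(lborel :: (real^'d) measure))"
    unfolding std_gaussian_def Basis
    by (subst prod.reindex[OF inj]) (simp add: emeasure_density inner_axis prod_ennreal)
  also have "\<dots> = (\<Prod>b\<in>(Basis::(real^'d) set). \<integral>\<^sup>+y. ennreal (std_normal_density y) \<partial>lborel)"
    by (rule nn_integral_lborel_prod) auto
  also have "(\<integral>\<^sup>+y. ennreal (std_normal_density y) \<partial>lborel) = 1"
    using prob_space.emeasure_space_1[OF prob_space_normal_density[of 1 0]] by (simp add: emeasure_density)
  finally show "emeasure (std_gaussian :: (real^'d) measure) (space std_gaussian) = 1" by simp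
qed

lemma char_std_gaussian:
  "(\<integral>x. iexp (t \<bullet> x) \<partial>(std_gaussian :: (real^'d) measure)) = of_real (exp (- (norm t)\<^sup>2 / 2))"
proof -
  interpret real_distribution std_normal_distribution
    by (rule real_dist_normal_dist)
  have "(\<integral>x. iexp (t \<bullet> x) \<partial>(std_gaussian :: (real^'d) measure)) =
     (\<integral>x. (\<Prod>i\<in>UNIV. iexp (t $ i * x $ i)) \<partial>(std_gaussian :: (real^'d) measure))"
    by (simp add: inner_vec_def sum_distrib_left exp_sum)
  also have "\<dots> = (\<Prod>i\<in>UNIV. \<integral>y. iexp (t $ i * y) \<partial>std_normal_distribution)"
    by (rule std_gaussian_integral_prod) (auto intro!: integrable_iexp)
  also have "\<dots> = (\<Prod>i\<in>UNIV. of_real (exp (- (t $ i)\<^sup>2 / 2)))"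
    using char_std_normal_distribution by (simp add: char_def fun_eq_iff)
  also have "\<dots> = of_real (exp (- (norm t)\<^sup>2 / 2))"
    by (simp add: norm_vec_def L2_set_def sum_nonneg exp_sum[symmetric] of_real_prod[symmetric] sum_negf sum_divide_distrib del: of_real_prod)
  finally show ?thesis .
qed

section \<open>The positive definite square root\<close>

text \<open>Writing a square root of \<open>1 - C\<close> as \<open>1 - X\<close> turns \<open>(1 - X)\<^sup>2 = 1 - C\<close> into the fixed point
  equation \<open>X = (C + X\<^sup>2) / 2\<close>, whose right-hand side is a contraction on the ball of radius
  \<open>\<rho> < 1\<close>. Self-adjointness and commutation with everything that commutes with \<open>C\<close> are closed
  conditions that the iteration preserves, so the fixed point inherits them.\<close>

lemma contraction_sqrt:
  fixes C :: "'a::{real_inner,banach} \<Rightarrow>\<^sub>L 'a"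
  assumes sym: "\<And>x y. C x \<bullet> y = x \<bullet> C y" and \<rho>: "norm C \<le> \<rho>" "\<rho> < 1"
  obtains X :: "'a \<Rightarrow>\<^sub>L 'a" where "norm X \<le> \<rho>" "\<And>x y. X x \<bullet> y = x \<bullet> X y"
    "C + (X o\<^sub>L X) = 2 *\<^sub>R X" "\<And>D. D o\<^sub>L C = C o\<^sub>L D \<Longrightarrow> D o\<^sub>L X = X o\<^sub>L D"
proof -
  define s where "s = {X :: 'a \<Rightarrow>\<^sub>L 'a. norm X \<le> \<rho> \<and> (\<forall>x y. blinfun_apply X x \<bullet> y = x \<bullet> blinfun_apply X y) \<and>
    (\<forall>D. D o\<^sub>L C = C o\<^sub>L D \<longrightarrow> D o\<^sub>L X = X o\<^sub>L D)}"
  define F where "F X = (1/2) *\<^sub>R (C + (X o\<^sub>L X))" for X :: "'a \<Rightarrow>\<^sub>L 'a"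
  have \<rho>0: "0 \<le> \<rho>" using \<rho>(1) norm_ge_zero order_trans by blast
  have "\<exists>!X\<in>s. F X = X"
  proof (rule Banach_fix[where c=\<rho>])
    have "closed s" unfolding s_def
      by (intro closed_Collect_conj closed_Collect_all closed_Collect_imp closed_Collect_le closed_Collect_eq
          open_Collect_const continuous_intros)
    then show "uniform_space_class.complete s" by (simp add: complete_eq_closed)
    have "0 \<in> s" using \<rho>0 by (simp add: s_def)
    then show "s \<noteq> {}" by blast
    show "F ` s \<subseteq> s"
    proof clarify
      fix X assume X: "X \<in> s"
      then have nX: "norm X \<le> \<rho>" and symX: "\<And>x y. X x \<bullet> y = x \<bullet> X y"
        and cX: "\<And>D. D o\<^sub>L C = C o\<^sub>L D \<Longrightarrow> D o\<^sub>L X = X o\<^sub>L D" unfolding s_def by blast+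
      have "norm (C + (X o\<^sub>L X)) \<le> \<rho> + \<rho> * \<rho>"
        by (intro norm_triangle_le add_mono \<rho>(1) order_trans[OF norm_blinfun_compose] mult_mono nX \<rho>0 norm_ge_zero)
      also have "\<dots> \<le> 2 * \<rho>" using mult_left_mono[of \<rho> 1 \<rho>] \<rho>0 \<rho>(2) by simp
      finally have "norm (F X) \<le> \<rho>" by (simp add: F_def)
      moreover have "F X x \<bullet> y = x \<bullet> F X y" for x y
        by (simp add: F_def blinfun.bilinear_simps inner_add_left inner_add_right sym symX)
      moreover have "D o\<^sub>L F X = F X o\<^sub>L D" if D: "D o\<^sub>L C = C o\<^sub>L D" for D
      proof (rule blinfun_eqI)
        fix x
        have "D (C x) = C (D x)" for x
          using arg_cong[OF D, of "\<lambda>T. blinfun_apply T x"] by simp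
        moreover have "D (X x) = X (D x)" for x
          using arg_cong[OF cX[OF D], of "\<lambda>T. blinfun_apply T x"] by simp
        ultimately show "(D o\<^sub>L F X) x = (F X o\<^sub>L D) x"
          by (simp add: F_def blinfun.bilinear_simps)
      qed
      ultimately show "F X \<in> s" unfolding s_def by blast
    qed
    show "dist (F X) (F Y) \<le> \<rho> * dist X Y" if "X \<in> s" "Y \<in> s" for X Y
    proof -
      have XY: "norm X \<le> \<rho>" "norm Y \<le> \<rho>" using that unfolding s_def by blast+
      have "F X - F Y = (1/2) *\<^sub>R ((X o\<^sub>L (X - Y)) + ((X - Y) o\<^sub>L Y))"
        by (rule blinfun_eqI) (simp add: F_def blinfun.bilinear_simps algebra_simps)
      also have "norm \<dots> \<le> (1/2) * (\<rho> * norm (X - Y) + norm (X - Y) * \<rho>)"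
        unfolding norm_scaleR
        by (intro mult_mono norm_triangle_le add_mono order_trans[OF norm_blinfun_compose])
           (use XY \<rho>0 in auto)
      finally show ?thesis by (simp add: dist_norm)
    qed
  qed (use \<rho>0 \<rho> in auto)
  then obtain X where X: "X \<in> s" "F X = X" by blast
  show thesis
  proof (rule that[of X])
    have "C + (X o\<^sub>L X) = 2 *\<^sub>R F X" by (simp add: F_def)
    then show "C + (X o\<^sub>L X) = 2 *\<^sub>R X" unfolding X(2) .
  qed (use X(1) in \<open>unfold s_def, blast+\<close>)
qed

lemma positive_definite_symmetric:
  assumes "positive_definite A"
  shows "(A *v x) \<bullet> y = x \<bullet> (A *v y)"
  using assms dot_lmul_matrix[of x A y] transpose_matrix_vector[of A x] by (simp add: positive_definite_def)

text \<open>The quadratic form attains its minimum on the compact unit sphere, and this minimum is positive.\<close>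

lemma positive_definite_coercive:
  fixes A :: "real^'d^'d"
  assumes "positive_definite A"
  obtains l where "l > 0" "\<And>x. l * (norm x)\<^sup>2 \<le> x \<bullet> (A *v x)"
proof -
  have "\<exists>x\<in>sphere (0::real^'d) 1. \<forall>y\<in>sphere 0 1. x \<bullet> (A *v x) \<le> y \<bullet> (A *v y)"
  proof (rule continuous_attains_inf)
    have "norm (axis undefined 1 :: real^'d) = 1" by simp
    then show "sphere (0::real^'d) 1 \<noteq> {}" by (metis mem_sphere_0 empty_iff)
  qed (auto intro!: continuous_intros)
  then obtain u :: "real^'d" where u: "norm u = 1" "\<And>y. norm y = 1 \<Longrightarrow> u \<bullet> (A *v u) \<le> y \<bullet> (A *v y)"
    by auto
  show thesis
  proof
    show "0 < u \<bullet> (A *v u)"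
    proof -
      have "u \<noteq> 0" using u(1) by auto
      then show ?thesis using assms by (simp add: positive_definite_def)
    qed
    fix x :: "real^'d"
    show "u \<bullet> (A *v u) * (norm x)\<^sup>2 \<le> x \<bullet> (A *v x)"
    proof (cases "x = 0")
      case False
      have "u \<bullet> (A *v u) \<le> ((1 / norm x) *\<^sub>R x) \<bullet> (A *v ((1 / norm x) *\<^sub>R x))"
        by (rule u(2)) (use False in simp)
      also have "\<dots> = (x \<bullet> (A *v x)) / (norm x)\<^sup>2"
        by (simp add: matrix_vector_mult_scaleR power2_eq_square)
      finally show ?thesis using False by (simp add: pos_le_divide_eq)
    qed simp
  qed
qed

text \<open>With \<open>l\<close> a lower bound of the quadratic form and \<open>K\<close> an upper bound of the operator,
  \<open>norm (x - r A x)\<^sup>2 \<le> (1 - 2 r l + r\<^sup>2 K\<^sup>2) * (norm x)\<^sup>2\<close>. The choice \<open>r = l / K\<^sup>2\<close> minimizes the factor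
  and makes \<open>1 - r A\<close> a strict contraction, to which the fixed point construction applies.\<close>

lemma positive_definite_sqrt_exists:
  fixes A :: "real^'d^'d"
  assumes A: "positive_definite A"
  obtains T where "positive_definite T" "T ** T = A" "\<And>D. D ** A = A ** D \<Longrightarrow> D ** T = T ** D"
proof -
  obtain l where l: "l > 0" "\<And>x. l * (norm x)\<^sup>2 \<le> x \<bullet> (A *v x)"
    using positive_definite_coercive[OF A] by blast
  \<comment> \<open>The summand \<open>l\<close> ensures \<open>0 < l \<le> K\<close>, so that the contraction factor is real.\<close>
  define K where "K = onorm ((*v) A) + l"
  have K: "l \<le> K" "\<And>x. norm (A *v x) \<le> K * norm x"
  proof -
    have "0 \<le> onorm ((*v) A)" by (rule onorm_pos_le[OF matrix_vector_mul_bounded_linear])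
    then show "l \<le> K" by (simp add: K_def)
    fix x
    have "norm (A *v x) \<le> onorm ((*v) A) * norm x"
      by (rule onorm[OF matrix_vector_mul_bounded_linear])
    also have "\<dots> \<le> K * norm x" using l by (intro mult_right_mono) (auto simp: K_def)
    finally show "norm (A *v x) \<le> K * norm x" .
  qed
  define r where "r = l / K\<^sup>2"
  define \<rho> where "\<rho> = sqrt (1 - l\<^sup>2 / K\<^sup>2)"
  have K0: "K > 0" using K(1) l(1) by simp
  have r: "r > 0" using l(1) K0 by (simp add: r_def)
  have ratio: "0 < l\<^sup>2 / K\<^sup>2" "l\<^sup>2 / K\<^sup>2 \<le> 1"
    using l(1) K0 K(1) by (auto simp: power_mono)
  then have \<rho>: "0 \<le> \<rho>" "\<rho> < 1" by (auto simp: \<rho>_def)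
  define C where "C = id_blinfun - r *\<^sub>R Blinfun ((*v) A)"
  have C: "C x = x - r *\<^sub>R (A *v x)" for x
    by (simp add: C_def blinfun.bilinear_simps bounded_linear_Blinfun_apply)
  have normC: "norm C \<le> \<rho>"
  proof (rule norm_blinfun_bound[OF \<rho>(1)])
    fix x
    have "(norm (C x))\<^sup>2 = (norm x)\<^sup>2 - 2 * r * (x \<bullet> (A *v x)) + r\<^sup>2 * (norm (A *v x))\<^sup>2"
      by (simp add: C power2_norm_eq_inner inner_diff_left inner_diff_right inner_commute)
         (simp add: power2_eq_square)
    also have "\<dots> \<le> (norm x)\<^sup>2 - 2 * r * (l * (norm x)\<^sup>2) + r\<^sup>2 * (K * norm x)\<^sup>2"
      using r l(2)[of x] power_mono[OF K(2)[of x] norm_ge_zero, of 2]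
      by (intro add_mono diff_mono mult_left_mono) auto
    also have "\<dots> = (\<rho> * norm x)\<^sup>2"
      using ratio K0 by (simp add: \<rho>_def power_mult_distrib r_def field_simps power2_eq_square)
    finally show "norm (C x) \<le> \<rho> * norm x"
      by (rule power2_le_imp_le) (simp add: \<rho>)
  qed
  have symC: "C x \<bullet> y = x \<bullet> C y" for x y
    by (simp add: C inner_diff_left inner_diff_right positive_definite_symmetric[OF A])
  obtain X :: "(real^'d) \<Rightarrow>\<^sub>L (real^'d)" where X: "norm X \<le> \<rho>" "\<And>x y. X x \<bullet> y = x \<bullet> X y"
      and sq: "C + (X o\<^sub>L X) = 2 *\<^sub>R X" and comm: "\<And>D. D o\<^sub>L C = C o\<^sub>L D \<Longrightarrow> D o\<^sub>L X = X o\<^sub>L D"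
    by (rule contraction_sqrt[OF symC normC \<rho>(2)], rule that)
  define T where "T = matrix (\<lambda>x. (1 / sqrt r) *\<^sub>R (x - X x))"
  have T: "T *v x = (1 / sqrt r) *\<^sub>R (x - X x)" for x
  proof -
    have "linear (\<lambda>x. (1 / sqrt r) *\<^sub>R (x - X x))"
      by (rule linearI) (simp_all add: blinfun.bilinear_simps algebra_simps)
    then show ?thesis unfolding T_def by simp
  qed
  show thesis
  proof
    show "positive_definite T"
      unfolding positive_definite_def
    proof (intro conjI allI impI)
      have "transpose T *v x = T *v x" for x
      proof (rule vector_eq_ldot[THEN iffD1, rule_format])
        fix y
        have "y \<bullet> (transpose T *v x) = (T *v y) \<bullet> x"
          by (simp add: dot_lmul_matrix inner_commute[of y])
             (simp add: inner_commute)
        also have "\<dots> = y \<bullet> (T *v x)"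
          by (simp add: T inner_diff_left inner_diff_right X(2))
        finally show "y \<bullet> (transpose T *v x) = y \<bullet> (T *v x)" .
      qed
      then show "transpose T = T" by (simp add: matrix_eq)
      fix x :: "real^'d" assume x: "x \<noteq> 0"
      have "x \<bullet> X x \<le> norm x * norm (X x)" by (rule norm_cauchy_schwarz)
      also have "\<dots> \<le> norm x * (\<rho> * norm x)"
        using norm_blinfun[of X x] mult_right_mono[OF X(1) norm_ge_zero, of x]
        by (intro mult_left_mono) auto
      also have "\<dots> < x \<bullet> x"
        using x \<rho> by (simp add: power2_norm_eq_inner[symmetric] power2_eq_square)
      finally show "0 < x \<bullet> (T *v x)"
        using r by (simp add: T inner_diff_right)
    qed
    show "T ** T = A"
    proof (subst matrix_eq, rule allI)
      fix x
      have "x - r *\<^sub>R (A *v x) + X (X x) = 2 *\<^sub>R X x"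
        using arg_cong[OF sq, of "\<lambda>T. blinfun_apply T x"] by (simp add: blinfun.bilinear_simps C)
      then have "r *\<^sub>R (A *v x) = x - X x - X (x - X x)"
        by (simp add: blinfun.bilinear_simps scaleR_2 algebra_simps)
      then have "(1 / r) *\<^sub>R (x - X x - X (x - X x)) = (1 / r) *\<^sub>R (r *\<^sub>R (A *v x))"
        by (rule arg_cong[OF sym])
      also have "\<dots> = A *v x" using r by simp
      finally have inv: "(1 / r) *\<^sub>R (x - X x - X (x - X x)) = A *v x" .
      have "(T ** T) *v x = T *v (T *v x)"
        by (simp add: matrix_vector_mul_assoc)
      also have "\<dots> = (1 / sqrt r * (1 / sqrt r)) *\<^sub>R (x - X x - X (x - X x))"
        unfolding T blinfun.scaleR_right scaleR_diff_right[symmetric] scaleR_scaleR ..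
      also have "1 / sqrt r * (1 / sqrt r) = 1 / r"
        using r by simp
      finally show "(T ** T) *v x = A *v x"
        by (simp only: inv)
    qed
    fix D :: "real^'d^'d" assume D: "D ** A = A ** D"
    have apply_D: "blinfun_apply (Blinfun ((*v) D)) = (*v) D"
      by (rule bounded_linear_Blinfun_apply) (rule matrix_vector_mul_bounded_linear)
    have DC: "Blinfun ((*v) D) o\<^sub>L C = C o\<^sub>L Blinfun ((*v) D)"
    proof (rule blinfun_eqI)
      fix x
      have "D *v (A *v x) = A *v (D *v x)"
        unfolding matrix_vector_mul_assoc D ..
      then show "(Blinfun ((*v) D) o\<^sub>L C) x = (C o\<^sub>L Blinfun ((*v) D)) x"
        by (simp only: blinfun_apply_blinfun_compose apply_D C matrix_vector_mult_diff_distrib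
          matrix_vector_mult_scaleR)
    qed
    have DX: "D *v (X x) = X (D *v x)" for x
      using arg_cong[OF comm[OF DC], of "\<lambda>T. blinfun_apply T x"]
      by (simp only: blinfun_apply_blinfun_compose apply_D)
    show "D ** T = T ** D"
      unfolding matrix_eq matrix_vector_mul_assoc[symmetric] T matrix_vector_mult_diff_distrib
          matrix_vector_mult_scaleR DX by simp
  qed
qed

text \<open>If \<open>R\<close> is another positive definite root, it commutes with \<open>R ** R = A\<close> and hence with the
  constructed root \<open>T\<close>. Then \<open>R + T\<close> annihilates the range of \<open>R - T\<close>; being positive definite, it
  is injective, so \<open>R = T\<close>.\<close>

lemma matrix_sqrt_positive_definite:
  fixes A :: "real^'d^'d"
  assumes A: "positive_definite A"
  shows "positive_definite (matrix_sqrt A) \<and> matrix_sqrt A ** matrix_sqrt A = A"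
  unfolding matrix_sqrt_def
proof (rule theI')
  obtain T where T: "positive_definite T" "T ** T = A" "\<And>D. D ** A = A ** D \<Longrightarrow> D ** T = T ** D"
    by (rule positive_definite_sqrt_exists[OF A], rule that)
  show "\<exists>!T. positive_definite T \<and> T ** T = A"
  proof (rule ex1I[of _ T], goal_cases)
    case 1
    show ?case using T by blast
  next
    case (2 R)
    have comm: "R ** T = T ** R"
      by (rule T(3)) (use 2 in \<open>auto simp: matrix_mul_assoc\<close>)
    have "R *v x = T *v x" for x
    proof (rule ccontr)
      assume "R *v x \<noteq> T *v x"
      define y where "y = R *v x - T *v x"
      have y: "y \<noteq> 0" using \<open>R *v x \<noteq> T *v x\<close> by (simp add: y_def)
      have "R *v y + T *v y = (R ** R) *v x - (T ** T) *v x + ((T ** R) *v x - (R ** T) *v x)"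
        by (simp add: y_def matrix_vector_mult_diff_distrib matrix_vector_mul_assoc)
      also have "\<dots> = 0" using 2 T(2) comm by simp
      finally have "y \<bullet> (R *v y + T *v y) = 0" by simp
      moreover have "0 < y \<bullet> (R *v y)" "0 < y \<bullet> (T *v y)"
        using 2 T(1) y by (auto simp: positive_definite_def)
      ultimately show False by (simp add: inner_add_right)
    qed
    then show ?case by (simp add: matrix_eq)
  qed
qed

section \<open>Asymptotics of harmonic products of characteristic functions\<close>

lemma norm_exp_minus_linear_le:
  fixes z :: complex
  assumes "norm z \<le> 1"
  shows "norm (exp z - (1 + z)) \<le> 3 * (norm z)\<^sup>2"
proof -
  have "norm (exp z - (1 + z)) \<le> exp \<bar>Re z\<bar> * (norm z)\<^sup>2"
    using Taylor_exp[of z 1] by (simp add: numeral_2_eq_2)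
  also have "\<dots> \<le> 3 * (norm z)\<^sup>2"
  proof (intro mult_right_mono)
    have "exp \<bar>Re z\<bar> \<le> exp 1" using abs_Re_le_cmod[of z] assms by simp
    then show "exp \<bar>Re z\<bar> \<le> 3" using exp_le by linarith
  qed simp
  finally show ?thesis .
qed

lemma sum_inverse_squares_le: "(\<Sum>k<n. 1 / (real k + 2)\<^sup>2) \<le> 1"
proof -
  have "(\<Sum>k<n. 1 / (real k + 2)\<^sup>2) \<le> 1 - 1 / (real n + 1)"
  proof (induction n)
    case (Suc n)
    have "1 / (real n + 2)\<^sup>2 \<le> 1 / (real n + 1) - 1 / (real n + 2)"
    proof -
      have "1 / (real n + 2)\<^sup>2 \<le> 1 / ((real n + 1) * (real n + 2))"
        by (intro frac_le) (auto simp: power2_eq_square)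
      also have "\<dots> = 1 / (real n + 1) - 1 / (real n + 2)"
        by (simp add: divide_simps)
      finally show ?thesis .
    qed
    then show ?case using Suc by (simp add: algebra_simps)
  qed simp
  also have "\<dots> \<le> 1" by simp
  finally show ?thesis .
qed

text \<open>All factors \<open>1 + w / (k + 2)\<close> and \<open>exp (w / (k + 2))\<close> lie in the closed unit disc: the former is
  a convex combination of \<open>1\<close> and \<open>1 + w\<close>, and \<open>Re w \<le> 0\<close>. Products of such numbers differ by at
  most the sum of the differences of their factors, and each difference is quadratic in
  \<open>w / (k + 2)\<close>. The bound is uniform in \<open>n\<close>.\<close>

lemma prod_one_plus_harmonic_approx:
  fixes w :: complex
  assumes w: "norm (1 + w) \<le> 1"
  shows "norm ((\<Prod>k<n. 1 + w / of_nat (k + 2)) - exp (w * of_real (\<Sum>k<n. 1 / real (k + 2)))) \<le> 3 * (norm w)\<^sup>2"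
proof -
  define z where "z k = w / of_nat (k + 2)" for k :: nat
  have w2: "norm w \<le> 2"
    using norm_triangle_ineq4[of "1 + w" 1] w by simp
  have Re_w: "Re w \<le> 0"
    using complex_Re_le_cmod[of "1 + w"] w by simp
  have nz: "norm (z k) = norm w / (real k + 2)" for k
    unfolding z_def norm_divide norm_of_nat by simp
  have "exp (w * of_real (\<Sum>k<n. 1 / real (k + 2))) = (\<Prod>k<n. exp (z k))"
    by (simp add: exp_sum[symmetric] sum_distrib_left z_def)
  then have "norm ((\<Prod>k<n. 1 + w / of_nat (k + 2)) - exp (w * of_real (\<Sum>k<n. 1 / real (k + 2)))) =
      norm ((\<Prod>k<n. 1 + z k) - (\<Prod>k<n. exp (z k)))"
    by (simp add: z_def)
  also have "\<dots> \<le> (\<Sum>k<n. norm (1 + z k - exp (z k)))"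
  proof (rule norm_prod_diff)
    fix k
    have "1 + z k = (of_nat (k + 1) + (1 + w)) / of_nat (k + 2)"
    proof -
      have N: "of_nat (k + 1) + 1 = (of_nat (k + 2) :: complex)" "of_nat (k + 2) \<noteq> (0 :: complex)"
        by (simp, simp only: of_nat_eq_0_iff)
      show ?thesis
        unfolding z_def add.assoc[symmetric] N(1) add_divide_distrib divide_self[OF N(2)] ..
    qed
    also have "norm \<dots> = norm (of_nat (k + 1) + (1 + w)) / (real k + 2)"
      unfolding norm_divide norm_of_nat by simp
    also have "\<dots> \<le> (real (k + 1) + 1) / (real k + 2)"
    proof (rule divide_right_mono)
      have "norm (of_nat (k + 1) + (1 + w)) \<le> norm (of_nat (k + 1) :: complex) + norm (1 + w)"
        by (rule norm_triangle_ineq)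
      then show "norm (of_nat (k + 1) + (1 + w)) \<le> real (k + 1) + 1"
        unfolding norm_of_nat using w by linarith
    qed simp
    also have "\<dots> = 1" by simp
    finally show "norm (1 + z k) \<le> 1" .
    show "norm (exp (z k)) \<le> 1"
      using Re_w by (simp add: z_def Re_divide_of_nat divide_nonpos_pos)
  qed
  also have "\<dots> \<le> (\<Sum>k<n. 3 * (norm w)\<^sup>2 * (1 / (real k + 2)\<^sup>2))"
  proof (rule sum_mono)
    fix k
    have "norm (z k) \<le> 1" using w2 by (simp add: nz)
    then have "norm (exp (z k) - (1 + z k)) \<le> 3 * (norm (z k))\<^sup>2" by (rule norm_exp_minus_linear_le)
    then show "norm (1 + z k - exp (z k)) \<le> 3 * (norm w)\<^sup>2 * (1 / (real k + 2)\<^sup>2)"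
      by (simp add: norm_minus_commute nz power_divide)
  qed
  also have "\<dots> \<le> 3 * (norm w)\<^sup>2 * 1"
    unfolding sum_distrib_left[symmetric] by (intro mult_left_mono sum_inverse_squares_le) auto
  finally show ?thesis by simp
qed

lemma harmonic_minus_ln_tendsto:
  "(\<lambda>n. (\<Sum>k<n. 1 / real (k + 2)) - ln (real n)) \<longlonglongrightarrow> euler_mascheroni - 1"
proof -
  have eq: "(\<Sum>k<n. 1 / real (k + 2)) = harm n + 1 / (real n + 1) - 1" for n
    by (induction n) (simp_all add: harm_Suc harm_expand(1) divide_inverse add.commute)
  have "(\<lambda>n. (harm n - ln (real n)) + 1 / (real n + 1) - 1) \<longlonglongrightarrow> euler_mascheroni + 0 - 1"
    by (intro tendsto_intros euler_mascheroni_LIMSEQ) real_asymp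
  then show ?thesis unfolding eq by (simp add: algebra_simps)
qed

text \<open>The Taylor expansion of the characteristic function of a finitely supported law at the origin, in
  the scaling \<open>t = s / r\<close> with \<open>r \<rightarrow> \<infinity>\<close>: the third-order remainder is \<open>O(1 / r)\<close> after
  multiplication by \<open>r\<^sup>2\<close>.\<close>

lemma char_second_order_expansion:
  fixes p :: "'v::real_inner \<Rightarrow> real"
  assumes p: "finite B" "\<And>b. b \<in> B \<Longrightarrow> 0 \<le> p b" "sum p B = 1"
  shows "((\<lambda>r. of_real (r\<^sup>2) * ((\<Sum>b\<in>B. of_real (p b) * iexp (((1 / r) *\<^sub>R s) \<bullet> b)) - 1)
      - \<i> * of_real (r * (s \<bullet> (\<Sum>b\<in>B. p b *\<^sub>R b)))) \<longlongrightarrow> of_real (- (\<Sum>b\<in>B. p b * (s \<bullet> b)\<^sup>2) / 2)) at_top"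
proof (rule Lim_null[THEN iffD2], rule Lim_null_comparison)
  define c where "c = (\<Sum>b\<in>B. p b * \<bar>s \<bullet> b\<bar> ^ 3 / 6)"
  show "((\<lambda>r::real. c / r) \<longlongrightarrow> 0) at_top" by real_asymp
  show "\<forall>\<^sub>F r in at_top. norm (of_real (r\<^sup>2) * ((\<Sum>b\<in>B. of_real (p b) * iexp (((1 / r) *\<^sub>R s) \<bullet> b)) - 1)
      - \<i> * of_real (r * (s \<bullet> (\<Sum>b\<in>B. p b *\<^sub>R b))) - of_real (- (\<Sum>b\<in>B. p b * (s \<bullet> b)\<^sup>2) / 2)) \<le> c / r"
    using eventually_gt_at_top[of 0]
  proof eventually_elim
    case (elim r)
    define y where "y b = (s \<bullet> b) / r" for b
    have sB: "(\<Sum>b\<in>B. of_real (p b)) = (1::complex)"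
      unfolding of_real_sum[symmetric] p(3) by simp
    have "of_real (r\<^sup>2) * ((\<Sum>b\<in>B. of_real (p b) * iexp (((1 / r) *\<^sub>R s) \<bullet> b)) - 1)
        - \<i> * of_real (r * (s \<bullet> (\<Sum>b\<in>B. p b *\<^sub>R b))) - of_real (- (\<Sum>b\<in>B. p b * (s \<bullet> b)\<^sup>2) / 2)
      = (\<Sum>b\<in>B. of_real (r\<^sup>2 * p b) * (iexp (y b) - (\<Sum>k\<le>2. (\<i> * y b) ^ k / fact k)))"
      (is "?l = _")
    proof -
      have taylor: "(\<Sum>k\<le>2. (\<i> * of_real x) ^ k / fact k) = 1 + \<i> * of_real x - (of_real x)\<^sup>2 / (2::complex)" for x :: real
        by (simp add: numeral_2_eq_2 mult.assoc mult.left_commute)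
      have "of_real (r\<^sup>2 * p b) * (iexp (y b) - (\<Sum>k\<le>2. (\<i> * y b) ^ k / fact k)) =
        of_real (r\<^sup>2) * (of_real (p b) * iexp (y b)) - of_real (r\<^sup>2) * of_real (p b)
         - \<i> * of_real r * of_real (p b * (s \<bullet> b)) + of_real (p b * (s \<bullet> b)\<^sup>2) / 2" for b
      proof -
        have sb: "s \<bullet> b = r * y b" using elim by (simp add: y_def)
        show ?thesis unfolding taylor sb by (simp add: algebra_simps power2_eq_square)
      qed
      then have "(\<Sum>b\<in>B. of_real (r\<^sup>2 * p b) * (iexp (y b) - (\<Sum>k\<le>2. (\<i> * y b) ^ k / fact k))) =
        of_real (r\<^sup>2) * (\<Sum>b\<in>B. of_real (p b) * iexp (y b)) - of_real (r\<^sup>2) * (\<Sum>b\<in>B. of_real (p b))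
         - \<i> * of_real r * of_real (\<Sum>b\<in>B. p b * (s \<bullet> b)) + of_real (\<Sum>b\<in>B. p b * (s \<bullet> b)\<^sup>2) / 2"
        by (simp add: sum.distrib sum_subtractf sum_distrib_left sum_divide_distrib)
      moreover have "iexp (((1 / r) *\<^sub>R s) \<bullet> b) = iexp (y b)" for b
        by (simp add: y_def)
      moreover have "s \<bullet> (\<Sum>b\<in>B. p b *\<^sub>R b) = (\<Sum>b\<in>B. p b * (s \<bullet> b))"
        by (simp add: inner_sum_right)
      ultimately show ?thesis
        unfolding sB by (simp add: right_diff_distrib)
    qed
    also have "norm \<dots> \<le> (\<Sum>b\<in>B. p b * \<bar>s \<bullet> b\<bar> ^ 3 / 6 / r)"
    proof (rule sum_norm_le)
      fix b assume b: "b \<in> B"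
      have "norm (of_real (r\<^sup>2 * p b) * (iexp (y b) - (\<Sum>k\<le>2. (\<i> * y b) ^ k / fact k))) \<le> (r\<^sup>2 * p b) * (\<bar>y b\<bar> ^ 3 / 6)"
        unfolding norm_mult
      proof (rule mult_mono)
        show "norm (of_real (r\<^sup>2 * p b) :: complex) \<le> r\<^sup>2 * p b"
          unfolding norm_of_real using p(2)[OF b] by simp
        have "Suc 2 = 3" "fact 3 = (6::real)" by (simp_all add: eval_nat_numeral)
        then show "norm (iexp (y b) - (\<Sum>k\<le>2. (\<i> * y b) ^ k / fact k)) \<le> \<bar>y b\<bar> ^ 3 / 6"
          using iexp_approx1[of "y b" 2] by presburger
      qed (use p(2)[OF b] in auto)
      also have "\<dots> = p b * \<bar>s \<bullet> b\<bar> ^ 3 / 6 / r"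
        using elim by (simp add: y_def field_simps eval_nat_numeral)
      finally show "norm (of_real (r\<^sup>2 * p b) * (iexp (y b) - (\<Sum>k\<le>2. (\<i> * y b) ^ k / fact k))) \<le> p b * \<bar>s \<bullet> b\<bar> ^ 3 / 6 / r" .
    qed
    also have "\<dots> = c / r" by (simp add: c_def sum_divide_distrib)
    finally show ?case .
  qed
qed

lemma norm_char_le_1:
  assumes "\<And>b. b \<in> B \<Longrightarrow> 0 \<le> p b" "sum p B = 1"
  shows "norm (\<Sum>b\<in>B. of_real (p b) * iexp (t \<bullet> b)) \<le> 1"
proof -
  have "norm (\<Sum>b\<in>B. of_real (p b) * iexp (t \<bullet> b)) \<le> (\<Sum>b\<in>B. p b)"
    by (rule sum_norm_le) (use assms in \<open>simp add: norm_mult\<close>)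
  then show ?thesis using assms by simp
qed

text \<open>With \<open>r = sqrt (ln n)\<close> and \<open>w = \<psi> (s / r) - 1\<close>, the product is \<open>exp (w * H)\<close> up to an error of order
  \<open>(norm w)\<^sup>2\<close>, where \<open>H - ln n\<close> converges. Since \<open>w \<rightarrow> 0\<close>, the exponent \<open>w * H\<close> may be replaced by
  \<open>w * r\<^sup>2\<close>, to which the second-order expansion applies.\<close>

lemma harmonic_product_char_limit:
  fixes p :: "'v::real_inner \<Rightarrow> real" and \<phi> :: "nat \<Rightarrow> 'v \<Rightarrow> complex"
  assumes p: "finite B" "\<And>b. b \<in> B \<Longrightarrow> 0 \<le> p b" "sum p B = 1"
    and \<phi>: "\<And>n t. \<phi> n t = \<phi> 0 t * (\<Prod>k<n. 1 + ((\<Sum>b\<in>B. of_real (p b) * iexp (t \<bullet> b)) - 1) / of_nat (k + 2))"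
    and \<phi>0: "isCont (\<phi> 0) 0" "\<phi> 0 0 = 1"
  shows "(\<lambda>n. exp (- \<i> * of_real (sqrt (ln (real n)) * (s \<bullet> (\<Sum>b\<in>B. p b *\<^sub>R b)))) * \<phi> n ((1 / sqrt (ln (real n))) *\<^sub>R s))
    \<longlonglongrightarrow> of_real (exp (- (\<Sum>b\<in>B. p b * (s \<bullet> b)\<^sup>2) / 2))"
proof -
  define m where "m = (\<Sum>b\<in>B. p b *\<^sub>R b)"
  define Q where "Q = (\<Sum>b\<in>B. p b * (s \<bullet> b)\<^sup>2)"
  define r where "r n = sqrt (ln (real n))" for n :: nat
  define t where "t n = (1 / r n) *\<^sub>R s" for n
  define w where "w n = (\<Sum>b\<in>B. of_real (p b) * iexp (t n \<bullet> b)) - 1" for n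
  define H where "H n = (\<Sum>k<n. 1 / real (k + 2))" for n :: nat
  have r_top: "filterlim r at_top sequentially"
    unfolding r_def[abs_def]
    by (rule filterlim_compose[OF sqrt_at_top filterlim_compose[OF ln_at_top filterlim_real_sequentially]])
  have r_inv: "(\<lambda>n. 1 / r n) \<longlonglongrightarrow> 0"
    by (intro tendsto_divide_0[OF tendsto_const] filterlim_at_top_imp_at_infinity r_top)
  have t_0: "t \<longlonglongrightarrow> 0"
    unfolding t_def[abs_def] using tendsto_scaleR[OF r_inv tendsto_const, of s] by simp
  have w_0: "w \<longlonglongrightarrow> 0"
  proof -
    have "(\<lambda>n. (\<Sum>b\<in>B. of_real (p b) * iexp (t n \<bullet> b)) - 1) \<longlonglongrightarrow> (\<Sum>b\<in>B. of_real (p b) * iexp (0 \<bullet> b)) - 1"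
      by (intro tendsto_intros t_0)
    moreover have "(\<Sum>b\<in>B. of_real (p b)) = (1::complex)"
      unfolding of_real_sum[symmetric] p(3) by simp
    ultimately show ?thesis unfolding w_def[abs_def] by simp
  qed
  have expansion: "(\<lambda>n. of_real ((r n)\<^sup>2) * w n - \<i> * of_real (r n * (s \<bullet> m))) \<longlonglongrightarrow> of_real (- Q / 2)"
    using filterlim_compose[OF char_second_order_expansion[OF p, of s] r_top]
    unfolding w_def t_def m_def Q_def .
  have bound: "norm ((\<Prod>k<n. 1 + w n / of_nat (k + 2)) - exp (w n * of_real (H n))) \<le> 3 * (norm (w n))\<^sup>2" for n
    unfolding H_def
    by (rule prod_one_plus_harmonic_approx) (use norm_char_le_1[OF p(2,3), of "t n"] in \<open>simp add: w_def\<close>)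
  have sq_0: "(\<lambda>n. 3 * (norm (w n))\<^sup>2) \<longlonglongrightarrow> 0"
    using tendsto_mult[OF tendsto_const[of 3] tendsto_power[OF tendsto_norm[OF w_0], of 2]] by simp
  have prod_diff: "(\<lambda>n. (\<Prod>k<n. 1 + w n / of_nat (k + 2)) - exp (w n * of_real (H n))) \<longlonglongrightarrow> 0"
    by (rule Lim_null_comparison[OF always_eventually[OF allI[OF bound]] sq_0])
  define rot where "rot n = exp (- \<i> * of_real (r n * (s \<bullet> m)))" for n
  have norm_rot: "norm (rot n) = 1" for n
    by (simp add: rot_def)
  have "(\<lambda>n. rot n * ((\<Prod>k<n. 1 + w n / of_nat (k + 2)) - exp (w n * of_real (H n)))) \<longlonglongrightarrow> 0"
    by (rule Lim_null_comparison[OF _ tendsto_norm_zero[OF prod_diff]]) (simp add: norm_mult norm_rot)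
  moreover have "(\<lambda>n. rot n * exp (w n * of_real (H n))) \<longlonglongrightarrow> exp (0 * of_real (euler_mascheroni - 1) + of_real (- Q / 2))"
  proof -
    have "(\<lambda>n. exp (w n * of_real (H n - ln (real n)) + (of_real ((r n)\<^sup>2) * w n - \<i> * of_real (r n * (s \<bullet> m))))) \<longlonglongrightarrow>
        exp (0 * of_real (euler_mascheroni - 1) + of_real (- Q / 2))"
      using harmonic_minus_ln_tendsto unfolding H_def[symmetric]
      by (intro tendsto_exp tendsto_add tendsto_mult tendsto_of_real expansion w_0)
    moreover have "\<forall>\<^sub>F n in sequentially. exp (w n * of_real (H n - ln (real n)) + (of_real ((r n)\<^sup>2) * w n - \<i> * of_real (r n * (s \<bullet> m))))
        = rot n * exp (w n * of_real (H n))"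
      using eventually_ge_at_top[of 1]
    proof eventually_elim
      case (elim n)
      then have "(r n)\<^sup>2 = ln (real n)" by (simp add: r_def)
      then show ?case
        unfolding rot_def exp_add[symmetric] by (intro arg_cong[where f=exp]) (simp add: algebra_simps)
    qed
    ultimately show ?thesis by (rule Lim_transform_eventually)
  qed
  ultimately have "(\<lambda>n. rot n * ((\<Prod>k<n. 1 + w n / of_nat (k + 2)) - exp (w n * of_real (H n))) + rot n * exp (w n * of_real (H n)))
     \<longlonglongrightarrow> 0 + exp (0 * of_real (euler_mascheroni - 1) + of_real (- Q / 2))"
    by (rule tendsto_add)
  then have "(\<lambda>n. rot n * (\<Prod>k<n. 1 + w n / of_nat (k + 2))) \<longlonglongrightarrow> of_real (exp (- Q / 2))"
    unfolding mult_zero_left add_0 exp_of_real by (simp only: right_diff_distrib diff_add_cancel)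
  moreover have "(\<lambda>n. \<phi> 0 (t n)) \<longlonglongrightarrow> 1"
    using isCont_tendsto_compose[OF \<phi>0(1) t_0] \<phi>0(2) by simp
  ultimately have lim: "(\<lambda>n. \<phi> 0 (t n) * (rot n * (\<Prod>k<n. 1 + w n / of_nat (k + 2)))) \<longlonglongrightarrow> 1 * of_real (exp (- Q / 2))"
    by (intro tendsto_mult)
  have eq: "\<phi> 0 (t n) * (rot n * (\<Prod>k<n. 1 + w n / of_nat (k + 2))) = rot n * \<phi> n (t n)" for n
    unfolding \<phi>[of n "t n"] w_def by (simp only: mult_ac)
  show ?thesis
    using lim unfolding eq mult_1 unfolding rot_def t_def r_def m_def Q_def .
qed

section \<open>The mean color distribution of the urn\<close>

text \<open>Adding an increment to a color yields a color. The mass that the recursion moves therefore never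
  leaves the color set, and functions on the color set can be extended by zero.\<close>

lemma color_set_add:
  assumes "z \<in> color_set B" "b \<in> B"
  shows "z + b \<in> color_set B"
proof -
  obtain k :: nat and n :: "nat \<Rightarrow> nat" and c where z: "z = (\<Sum>i=1..k. real (n i) *\<^sub>R c i)"
    and k: "k \<ge> 1" and c: "\<forall>i\<in>{1..k}. c i \<in> B"
    using assms(1) unfolding color_set_def by blast
  define n' where "n' = n(Suc k := 1)"
  define c' where "c' = c(Suc k := b)"
  have "(\<Sum>i=1..Suc k. real (n' i) *\<^sub>R c' i) = (\<Sum>i=1..k. real (n' i) *\<^sub>R c' i) + b"
    by (simp add: n'_def c'_def)
  also have "(\<Sum>i=1..k. real (n' i) *\<^sub>R c' i) = z"
    unfolding z by (intro sum.cong) (auto simp: n'_def c'_def)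
  finally have "z + b = (\<Sum>i=1..Suc k. real (n' i) *\<^sub>R c' i)" ..
  moreover have "\<forall>i\<in>{1..Suc k}. c' i \<in> B"
    using c assms(2) by (auto simp: c'_def le_Suc_eq)
  moreover have "Suc k \<ge> 1" by simp
  ultimately show ?thesis unfolding color_set_def by blast
qed

lemma sum_support_shift:
  fixes e :: "'v::ab_group_add \<Rightarrow> real" and h :: "'v \<Rightarrow> 'c::real_vector"
  assumes F: "finite F" "\<And>v. e v \<noteq> 0 \<Longrightarrow> v + b \<in> F"
  shows "(\<Sum>v\<in>F. e (v - b) *\<^sub>R h v) = (\<Sum>v | e v \<noteq> 0. e v *\<^sub>R h (v + b))"
proof -
  have "(\<Sum>v\<in>F. e (v - b) *\<^sub>R h v) = (\<Sum>v\<in>(\<lambda>v. v + b) ` {v. e v \<noteq> 0}. e (v - b) *\<^sub>R h v)"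
  proof (rule sum.mono_neutral_right[OF F(1)])
    show "\<forall>v\<in>F - (\<lambda>v. v + b) ` {v. e v \<noteq> 0}. e (v - b) *\<^sub>R h v = 0"
    proof clarify
      fix v assume "v \<notin> (\<lambda>v. v + b) ` {v. e v \<noteq> 0}"
      then have "e (v - b) = 0" by (metis (mono_tags) diff_add_cancel image_eqI mem_Collect_eq)
      then show "e (v - b) *\<^sub>R h v = 0" by simp
    qed
  qed (use F(2) in auto)
  also have "\<dots> = (\<Sum>v | e v \<noteq> 0. e v *\<^sub>R h (v + b))"
    by (subst sum.reindex) (auto simp: inj_on_def)
  finally show ?thesis .
qed

context infinite_color_urn
begin

text \<open>The bound is all that integrability needs: a single draw adds at most one to an entry.\<close>

lemma U_bounds:
  assumes "\<omega> \<in> space M" "v \<in> color_set (set_pmf p)"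
  shows "0 \<le> U n \<omega> v \<and> U n \<omega> v \<le> u0 v + real n"
proof (induction n)
  case 0
  then show ?case using assms U_0 u0_nonneg by simp
next
  case (Suc n)
  then show ?case
    using assms U_Suc[OF assms, of n] pmf_nonneg[of p "v - Z n \<omega>"] pmf_le_1[of p "v - Z n \<omega>"] by simp
qed

lemma integrable_U:
  assumes "v \<in> color_set (set_pmf p)"
  shows "integrable M (\<lambda>\<omega>. U n \<omega> v)"
proof (rule integrable_const_bound[of _ "u0 v + real n"])
  show "AE \<omega> in M. norm (U n \<omega> v) \<le> u0 v + real n"
    using U_bounds[OF _ assms, of _ n] by (intro AE_I2) force
qed (rule U_measurable[OF assms])

lemma color_event:
  assumes "v \<in> color_set (set_pmf p)"
  shows "{\<omega> \<in> space M. Z n \<omega> = v} \<in> events"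
proof -
  have "Z n -` {v} \<inter> space M \<in> events"
    by (rule measurable_sets[OF Z_measurable]) (use assms in simp)
  then show ?thesis by (simp add: vimage_def Int_def conj_commute)
qed

lemma subalgebra_urn_history: "subalgebra M (urn_history M (color_set (set_pmf p)) U n)"
proof -
  let ?G = "{(\<lambda>\<omega>. U k \<omega> v) -` A \<inter> space M | k v A. k \<le> n \<and> v \<in> color_set (set_pmf p) \<and> A \<in> sets (borel :: real measure)}"
  have "?G \<subseteq> events"
    using measurable_sets[OF U_measurable] by blast
  moreover have "?G \<subseteq> Pow (space M)" by blast
  ultimately show ?thesis
    unfolding subalgebra_def urn_history_def
    by (simp add: sets_measure_of space_measure_of sets.sigma_sets_subset)
qed

text \<open>The tower property applied to the conditional selection probabilities.\<close>

lemma prob_color: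
  assumes v: "v \<in> color_set (set_pmf p)"
  shows "prob {\<omega> \<in> space M. Z n \<omega> = v} = expectation (\<lambda>\<omega>. U n \<omega> v) / (real n + 1)"
proof -
  let ?F = "urn_history M (color_set (set_pmf p)) U n"
  let ?E = "{\<omega> \<in> space M. Z n \<omega> = v}"
  interpret F: finite_measure_subalgebra M ?F
    by unfold_locales (rule subalgebra_urn_history)
  have int: "integrable M (indicator ?E :: 'a \<Rightarrow> real)"
    using color_event[OF v, of n] by (simp add: integrable_real_indicator emeasure_eq_measure)
  have "prob ?E = expectation (indicator ?E)"
    using color_event[OF v, of n] by simp
  also have "\<dots> = expectation (real_cond_exp M ?F (indicator ?E))"
    using F.real_cond_exp_int(2)[OF int] by simp
  also have "\<dots> = expectation (\<lambda>\<omega>. U n \<omega> v / (real n + 1))"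
    using Z_cond[OF v, of n] U_measurable[OF v, of n] by (intro integral_cong_AE) auto
  finally show ?thesis by simp
qed

text \<open>The normalized mean configuration, extended by zero to all of the space; by \<open>prob_color\<close> these are
  the point probabilities of \<open>Z n\<close>. The extension makes the recursion hold at every point without
  side conditions.\<close>

definition color_prob :: "nat \<Rightarrow> real^'d \<Rightarrow> real" where
  "color_prob n v = (if v \<in> color_set (set_pmf p) then expectation (\<lambda>\<omega>. U n \<omega> v) / (real n + 1) else 0)"

lemma color_prob_nonneg: "0 \<le> color_prob n v"
  using U_bounds[of _ v n] by (auto simp: color_prob_def intro!: divide_nonneg_nonneg integral_nonneg)

text \<open>Finite support of \<open>p\<close> turns the random increment \<open>p (v - Z n)\<close> into a finite combination of
  indicators of the events \<open>Z n = v - b\<close>.\<close>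

lemma expectation_U_Suc:
  assumes fin: "finite (set_pmf p)" and v: "v \<in> color_set (set_pmf p)"
  shows "expectation (\<lambda>\<omega>. U (Suc n) \<omega> v) =
    expectation (\<lambda>\<omega>. U n \<omega> v) + (\<Sum>b\<in>set_pmf p. pmf p b * color_prob n (v - b))"
proof -
  have ind: "expectation (\<lambda>\<omega>. indicator {\<omega> \<in> space M. Z n \<omega> = w} \<omega>) = color_prob n w"
    and ind_int: "integrable M (\<lambda>\<omega>. indicator {\<omega> \<in> space M. Z n \<omega> = w} \<omega> :: real)" for w
  proof -
    have "{\<omega> \<in> space M. Z n \<omega> = w} = {}" if "w \<notin> color_set (set_pmf p)"
      using measurable_space[OF Z_measurable, of _ n] that by auto
    then show "expectation (\<lambda>\<omega>. indicator {\<omega> \<in> space M. Z n \<omega> = w} \<omega>) = color_prob n w"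
      and "integrable M (\<lambda>\<omega>. indicator {\<omega> \<in> space M. Z n \<omega> = w} \<omega> :: real)"
      using prob_color[of w n] color_event[of w n]
      by (cases "w \<in> color_set (set_pmf p)";
          simp add: color_prob_def integrable_real_indicator emeasure_eq_measure)+
  qed
  have increment: "pmf p (v - Z n \<omega>) = (\<Sum>b\<in>set_pmf p. pmf p b * indicator {\<omega> \<in> space M. Z n \<omega> = v - b} \<omega>)"
    if "\<omega> \<in> space M" for \<omega>
  proof -
    have "(\<Sum>b\<in>set_pmf p. pmf p b * indicator {\<omega> \<in> space M. Z n \<omega> = v - b} \<omega>) =
        (\<Sum>b\<in>set_pmf p. if b = v - Z n \<omega> then pmf p b else 0)"
      using that by (intro sum.cong) (auto simp: algebra_simps)
    also have "\<dots> = pmf p (v - Z n \<omega>)"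
      using fin by (simp add: set_pmf_iff)
    finally show ?thesis ..
  qed
  have "expectation (\<lambda>\<omega>. U (Suc n) \<omega> v) =
      expectation (\<lambda>\<omega>. U n \<omega> v + (\<Sum>b\<in>set_pmf p. pmf p b * indicator {\<omega> \<in> space M. Z n \<omega> = v - b} \<omega>))"
    by (intro Bochner_Integration.integral_cong refl) (simp add: U_Suc[OF _ v] increment)
  also have "\<dots> = expectation (\<lambda>\<omega>. U n \<omega> v) + (\<Sum>b\<in>set_pmf p. pmf p b * color_prob n (v - b))"
    using integrable_U[OF v, of n] ind_int ind by (simp add: Bochner_Integration.integral_sum)
  finally show ?thesis .
qed

text \<open>Off the color set both sides vanish, because \<open>v - b\<close> is a color only if \<open>v\<close> is one.\<close>

lemma color_prob_Suc:
  assumes fin: "finite (set_pmf p)"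
  shows "(real n + 2) * color_prob (Suc n) v =
    (real n + 1) * color_prob n v + (\<Sum>b\<in>set_pmf p. pmf p b * color_prob n (v - b))"
proof (cases "v \<in> color_set (set_pmf p)")
  case True
  have "(real n + 2) * color_prob (Suc n) v = expectation (\<lambda>\<omega>. U (Suc n) \<omega> v)"
    "(real n + 1) * color_prob n v = expectation (\<lambda>\<omega>. U n \<omega> v)"
    using True by (simp_all add: color_prob_def add.commute)
  then show ?thesis using expectation_U_Suc[OF fin True, of n] by simp
next
  case False
  have "color_prob n (v - b) = 0" if "b \<in> set_pmf p" for b
    using False color_set_add[OF _ that, of "v - b"] by (auto simp: color_prob_def)
  then show ?thesis using False by (simp add: color_prob_def)
qed

lemma color_prob_0: "color_prob 0 v = (if v \<in> color_set (set_pmf p) then u0 v else 0)"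
proof -
  have "expectation (\<lambda>\<omega>. U 0 \<omega> v) = expectation (\<lambda>\<omega>. u0 v)" if "v \<in> color_set (set_pmf p)"
    by (intro Bochner_Integration.integral_cong refl) (use U_0 that in auto)
  then show ?thesis by (simp add: color_prob_def prob_space)
qed

lemma finite_support_color_prob:
  assumes fin: "finite (set_pmf p)"
  shows "finite {v. color_prob n v \<noteq> 0}"
proof (induction n)
  case 0
  show ?case
    by (rule finite_subset[OF _ u0_finite_support]) (auto simp: color_prob_0 split: if_splits)
next
  case (Suc n)
  let ?A = "{v. color_prob n v \<noteq> 0}"
  have "{v. color_prob (Suc n) v \<noteq> 0} \<subseteq> ?A \<union> (\<lambda>(z, b). z + b) ` (?A \<times> set_pmf p)"
  proof
    fix v assume "v \<in> {v. color_prob (Suc n) v \<noteq> 0}"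
    then have "(real n + 1) * color_prob n v + (\<Sum>b\<in>set_pmf p. pmf p b * color_prob n (v - b)) \<noteq> 0"
      unfolding color_prob_Suc[OF fin, symmetric] by (simp add: add_nonneg_eq_0_iff)
    then have "color_prob n v \<noteq> 0 \<or> (\<exists>b\<in>set_pmf p. color_prob n (v - b) \<noteq> 0)"
      by (metis (mono_tags, lifting) add.right_neutral mult_zero_right sum.neutral)
    then show "v \<in> ?A \<union> (\<lambda>(z, b). z + b) ` (?A \<times> set_pmf p)"
    proof
      assume "\<exists>b\<in>set_pmf p. color_prob n (v - b) \<noteq> 0"
      then obtain b where "b \<in> set_pmf p" "color_prob n (v - b) \<noteq> 0" by blast
      then have "v \<in> (\<lambda>(z, b). z + b) ` (?A \<times> set_pmf p)"
        by (intro image_eqI[of _ _ "(v - b, b)"]) auto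
      then show ?thesis by blast
    qed simp
  qed
  then show ?case by (rule finite_subset) (simp add: Suc fin)
qed

text \<open>The characteristic function of the mean color distribution, as a finite sum
  (see \<open>integral_mean_color_law\<close>).\<close>

definition mean_char :: "nat \<Rightarrow> real^'d \<Rightarrow> complex" where
  "mean_char n t = (\<Sum>v | color_prob n v \<noteq> 0. color_prob n v *\<^sub>R iexp (t \<bullet> v))"

text \<open>The recursion is a convolution, which the Fourier transform turns into a multiplication. The finite
  set \<open>?F\<close> contains all supports involved, so that every sum can be taken over it.\<close>

lemma mean_char_Suc:
  assumes fin: "finite (set_pmf p)"
  shows "mean_char (Suc n) t =
    mean_char n t * (1 + ((\<Sum>b\<in>set_pmf p. of_real (pmf p b) * iexp (t \<bullet> b)) - 1) / of_nat (n + 2))"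
proof -
  let ?A = "\<lambda>n. {v. color_prob n v \<noteq> 0}"
  let ?F = "?A n \<union> ?A (Suc n) \<union> (\<lambda>(z, b). z + b) ` (?A n \<times> set_pmf p)"
  have F: "finite ?F" using finite_support_color_prob[OF fin] fin by simp
  have on_F: "mean_char k t = (\<Sum>v\<in>?F. color_prob k v *\<^sub>R iexp (t \<bullet> v))" if "?A k \<subseteq> ?F" for k
    unfolding mean_char_def using that by (intro sum.mono_neutral_left F) auto
  have shift: "(\<Sum>v\<in>?F. color_prob n (v - b) *\<^sub>R iexp (t \<bullet> v)) = iexp (t \<bullet> b) * mean_char n t"
    if b: "b \<in> set_pmf p" for b
  proof -
    have "(\<Sum>v\<in>?F. color_prob n (v - b) *\<^sub>R iexp (t \<bullet> v)) = (\<Sum>v | color_prob n v \<noteq> 0. color_prob n v *\<^sub>R iexp (t \<bullet> (v + b)))"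
      by (rule sum_support_shift[OF F]) (use b in force)
    also have "\<dots> = iexp (t \<bullet> b) * mean_char n t"
      unfolding mean_char_def sum_distrib_left
      by (intro sum.cong) (auto simp: inner_add_right exp_add distrib_left)
    finally show ?thesis .
  qed
  have alg: "(c * x + y * x) / a = x * (1 + (y - 1) / a)" if "a \<noteq> 0" "a = c + 1" for a c x y :: complex
  proof -
    have "c * x + y * x = x * (a + (y - 1))" using that(2) by (simp add: algebra_simps)
    then show ?thesis using that(1) by (simp add: add_divide_distrib distrib_left)
  qed
  have "(of_nat (n + 2)) * mean_char (Suc n) t = (\<Sum>v\<in>?F. ((real n + 2) * color_prob (Suc n) v) *\<^sub>R iexp (t \<bullet> v))"
    by (subst on_F) (auto simp: sum_distrib_left scaleR_conv_of_real mult_ac add.commute)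
  also have "\<dots> = (\<Sum>v\<in>?F. (real n + 1) *\<^sub>R (color_prob n v *\<^sub>R iexp (t \<bullet> v)) +
      (\<Sum>b\<in>set_pmf p. pmf p b *\<^sub>R (color_prob n (v - b) *\<^sub>R iexp (t \<bullet> v))))"
    unfolding color_prob_Suc[OF fin] by (simp add: scaleR_add_left scaleR_sum_left)
  also have "\<dots> = (real n + 1) *\<^sub>R mean_char n t +
      (\<Sum>b\<in>set_pmf p. pmf p b *\<^sub>R (\<Sum>v\<in>?F. color_prob n (v - b) *\<^sub>R iexp (t \<bullet> v)))"
    unfolding sum.distrib by (subst on_F[of n], blast, subst sum.swap) (simp only: scaleR_sum_right)
  also have "\<dots> = (real n + 1) *\<^sub>R mean_char n t +
      (\<Sum>b\<in>set_pmf p. pmf p b *\<^sub>R (iexp (t \<bullet> b) * mean_char n t))"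
    by (intro arg_cong2[where f="(+)"] sum.cong refl) (simp add: shift)
  also have "\<dots> = (of_nat n + 1) * mean_char n t + (\<Sum>b\<in>set_pmf p. of_real (pmf p b) * iexp (t \<bullet> b)) * mean_char n t"
    by (simp add: scaleR_conv_of_real sum_distrib_right mult.assoc)
  finally have "mean_char (Suc n) t =
      ((of_nat n + 1) * mean_char n t + (\<Sum>b\<in>set_pmf p. of_real (pmf p b) * iexp (t \<bullet> b)) * mean_char n t) / of_nat (n + 2)"
    by (metis nonzero_mult_div_cancel_left of_nat_eq_0_iff add_is_0 zero_neq_numeral)
  also have "\<dots> = mean_char n t * (1 + ((\<Sum>b\<in>set_pmf p. of_real (pmf p b) * iexp (t \<bullet> b)) - 1) / of_nat (n + 2))"
    by (rule alg) (simp_all only: of_nat_eq_0_iff, simp_all)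
  finally show ?thesis .
qed

lemma mean_char_prod:
  assumes fin: "finite (set_pmf p)"
  shows "mean_char n t =
    mean_char 0 t * (\<Prod>k<n. 1 + ((\<Sum>b\<in>set_pmf p. of_real (pmf p b) * iexp (t \<bullet> b)) - 1) / of_nat (k + 2))"
  by (induction n) (simp_all only: mean_char_Suc[OF fin] prod.lessThan_Suc lessThan_0 prod.empty mult.assoc mult_1_right)

lemma isCont_mean_char: "isCont (mean_char n) t"
  unfolding mean_char_def[abs_def] by (intro continuous_intros)

lemma mean_char_0_0: "mean_char 0 0 = 1"
proof -
  have "mean_char 0 0 = of_real (\<Sum>v | color_prob 0 v \<noteq> 0. color_prob 0 v)"
    by (simp add: mean_char_def scaleR_conv_of_real)
  also have "(\<Sum>v | color_prob 0 v \<noteq> 0. color_prob 0 v) = (\<Sum>v | v \<in> color_set (set_pmf p) \<and> u0 v \<noteq> 0. u0 v)"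
    by (intro sum.cong) (auto simp: color_prob_0)
  finally show ?thesis by (simp add: u0_sum)
qed

text \<open>Evaluating the product formula at \<open>t = 0\<close>, where every factor is one.\<close>

lemma sum_color_prob:
  assumes fin: "finite (set_pmf p)"
  shows "(\<Sum>v | color_prob n v \<noteq> 0. color_prob n v) = 1"
proof -
  have "(\<Sum>b\<in>set_pmf p. complex_of_real (pmf p b)) = 1"
    using sum_pmf_eq_1[OF fin, of p] by (simp add: of_real_sum[symmetric] del: of_real_sum)
  then have "mean_char n 0 = 1"
    using mean_char_prod[OF fin, of n 0] by (simp add: mean_char_0_0)
  moreover have "mean_char n 0 = of_real (\<Sum>v | color_prob n v \<noteq> 0. color_prob n v)"
    by (simp add: mean_char_def scaleR_conv_of_real)
  ultimately show ?thesis by (metis of_real_eq_1_iff)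
qed

lemma mean_color_law_eq:
  "mean_color_law M (color_set (set_pmf p)) U n =
    distr (density (count_space (color_set (set_pmf p))) (\<lambda>v. ennreal (color_prob n v))) borel (\<lambda>v. v)"
  unfolding mean_color_law_def point_measure_def
  by (intro distr_cong density_cong) (auto simp: color_prob_def intro!: AE_I2)

lemma prob_space_mean_color_law:
  assumes fin: "finite (set_pmf p)"
  shows "prob_space (mean_color_law M (color_set (set_pmf p)) U n)"
proof -
  let ?S = "color_set (set_pmf p)"
  have supp: "{v \<in> ?S. 0 < ennreal (color_prob n v)} = {v. color_prob n v \<noteq> 0}"
    using color_prob_nonneg[of n] by (auto simp: color_prob_def less_le)
  have "(\<integral>\<^sup>+v. ennreal (color_prob n v) \<partial>count_space ?S) = (\<Sum>v | color_prob n v \<noteq> 0. ennreal (color_prob n v))"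
    unfolding supp[symmetric]
    by (rule nn_integral_count_space) (simp only: supp finite_support_color_prob[OF fin])
  also have "\<dots> = 1"
    using sum_color_prob[OF fin, of n] by (simp add: color_prob_nonneg)
  finally have total: "(\<integral>\<^sup>+v. ennreal (color_prob n v) \<partial>count_space ?S) = 1" .
  have "emeasure (density (count_space ?S) (\<lambda>v. ennreal (color_prob n v))) ?S =
      (\<integral>\<^sup>+v. ennreal (color_prob n v) * indicator ?S v \<partial>count_space ?S)"
    by (simp add: emeasure_density)
  also have "\<dots> = (\<integral>\<^sup>+v. ennreal (color_prob n v) \<partial>count_space ?S)"
    by (rule nn_integral_cong) simp
  finally have "prob_space (density (count_space ?S) (\<lambda>v. ennreal (color_prob n v)))"
    by (intro prob_spaceI) (simp add: total)
  then show ?thesis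
    unfolding mean_color_law_eq by (rule prob_space.prob_space_distr) simp
qed

lemma integral_mean_color_law:
  fixes h :: "real^'d \<Rightarrow> complex"
  assumes fin: "finite (set_pmf p)" and h: "h \<in> borel_measurable borel"
  shows "(\<integral>x. h x \<partial>mean_color_law M (color_set (set_pmf p)) U n) =
    (\<Sum>v | color_prob n v \<noteq> 0. color_prob n v *\<^sub>R h v)"
proof -
  let ?S = "color_set (set_pmf p)"
  have fin': "finite {v. color_prob n v \<noteq> 0}" by (rule finite_support_color_prob[OF fin])
  have sub: "{v \<in> ?S. color_prob n v *\<^sub>R h v \<noteq> 0} \<subseteq> {v. color_prob n v \<noteq> 0}" by auto
  have "(\<integral>x. h x \<partial>mean_color_law M ?S U n) = (\<integral>v. h v \<partial>density (count_space ?S) (\<lambda>v. ennreal (color_prob n v)))"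
    unfolding mean_color_law_eq by (rule integral_distr) (use h in simp_all)
  also have "\<dots> = (\<integral>v. color_prob n v *\<^sub>R h v \<partial>count_space ?S)"
    by (rule integral_density) (auto simp: color_prob_nonneg)
  also have "\<dots> = (\<Sum>v | v \<in> ?S \<and> color_prob n v *\<^sub>R h v \<noteq> 0. color_prob n v *\<^sub>R h v)"
    by (rule lebesgue_integral_count_space_finite_support) (rule finite_subset[OF sub fin'])
  also have "\<dots> = (\<Sum>v | color_prob n v \<noteq> 0. color_prob n v *\<^sub>R h v)"
    by (rule sum.mono_neutral_left[OF fin' sub]) (auto simp: color_prob_def)
  finally show ?thesis .
qed

end

section \<open>Moments of the increments and the central limit theorem\<close>

lemma integral_finite_law:
  fixes g :: "'v::{second_countable_topology,t2_space} \<Rightarrow> 'c::{banach,second_countable_topology}"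
  assumes Y: "Y \<in> borel_measurable N" and law: "distr N borel Y = distr (measure_pmf p) borel (\<lambda>x. x)"
    and fin: "finite (set_pmf p)" and g: "g \<in> borel_measurable borel"
  shows "(\<integral>\<omega>. g (Y \<omega>) \<partial>N) = (\<Sum>b\<in>set_pmf p. pmf p b *\<^sub>R g b)"
proof -
  have "(\<integral>\<omega>. g (Y \<omega>) \<partial>N) = (\<integral>x. g x \<partial>distr (measure_pmf p) borel (\<lambda>x. x))"
    unfolding law[symmetric] by (rule integral_distr[OF Y g, symmetric])
  also have "\<dots> = (\<integral>x. g x \<partial>measure_pmf p)"
    by (rule integral_distr) (use g in simp_all)
  also have "\<dots> = (\<Sum>b\<in>set_pmf p. pmf p b *\<^sub>R g b)"
    by (rule integral_measure_pmf[OF fin]) auto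
  finally show ?thesis .
qed

lemma outer_square_nth:
  "(transpose (rowvector y :: real^'d^1) ** rowvector y) = (\<chi> i j. y $ i * y $ j)"
  by (simp add: vec_eq_iff matrix_matrix_mult_def transpose_def rowvector_def)

text \<open>The second moment matrix is a convex combination of the outer squares with entries
  \<open>b $ i * b $ j\<close>, each of which has the quadratic form \<open>(s \<bullet> b)\<^sup>2\<close>.\<close>

lemma second_moment_quadratic_form:
  fixes p :: "(real^'d) pmf"
  assumes Y: "Y \<in> borel_measurable N" and law: "distr N borel Y = distr (measure_pmf p) borel (\<lambda>x. x)"
    and fin: "finite (set_pmf p)"
  shows "s \<bullet> (second_moment_matrix N Y *v s) = (\<Sum>b\<in>set_pmf p. pmf p b * (s \<bullet> b)\<^sup>2)"
proof -
  have "(\<lambda>y :: real^'d. (\<chi> i j. y $ i * y $ j)) \<in> borel_measurable borel"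
    by (intro borel_measurable_continuous_onI continuous_on_vec_lambda continuous_intros)
  from integral_finite_law[OF Y law fin this]
  have "second_moment_matrix N Y = (\<Sum>b\<in>set_pmf p. pmf p b *\<^sub>R (\<chi> i j. b $ i * b $ j))"
    unfolding second_moment_matrix_def outer_square_nth .
  moreover have "(\<Sum>b\<in>B. pmf p b *\<^sub>R (\<chi> i j. b $ i * b $ j)) *v s = (\<Sum>b\<in>B. (pmf p b * (s \<bullet> b)) *\<^sub>R b)" for B
  proof (induction B rule: infinite_finite_induct)
    case (insert b B)
    have "(\<chi> i j. b $ i * b $ j) *v s = (s \<bullet> b) *\<^sub>R b"
      by (simp add: vec_eq_iff matrix_vector_mult_def inner_vec_def sum_distrib_left sum_distrib_right mult_ac)
    then show ?case using insert
      by (simp add: matrix_vector_mult_add_rdistrib scaleR_matrix_vector_assoc[symmetric])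
  qed simp_all
  ultimately show ?thesis
    by (simp add: inner_sum_right power2_eq_square mult.assoc)
qed

text \<open>The image of \<open>A\<close> under an affine bijection is the preimage of \<open>A\<close> under its inverse, so the set
  function that defines \<open>centered_scaled\<close> is an image measure.\<close>

lemma centered_scaled_eq_distr:
  fixes T T' :: "real^'d^'d"
  assumes sets: "sets L = sets borel" and n: "n \<ge> 2" and T: "transpose T = T" "T ** T' = mat 1" "T' ** T = mat 1"
  shows "centered_scaled L m T n =
    distr L borel (\<lambda>y. T' *v ((1 / sqrt (ln (real n))) *\<^sub>R (y - ln (real n) *\<^sub>R m)))"
proof -
  define r where "r = sqrt (ln (real n))"
  have r: "r > 0" using n by (simp add: r_def)
  have row: "a v* T = T *v a" for a
    using transpose_matrix_vector[of T a] T(1) by simp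
  have "(\<lambda>a. r *\<^sub>R (a v* T) + ln (real n) *\<^sub>R m) ` A =
      (\<lambda>y. T' *v ((1 / r) *\<^sub>R (y - ln (real n) *\<^sub>R m))) -` A \<inter> UNIV" for A
  proof safe
    fix a assume "a \<in> A"
    then show "r *\<^sub>R (a v* T) + ln (real n) *\<^sub>R m \<in> (\<lambda>y. T' *v ((1 / r) *\<^sub>R (y - ln (real n) *\<^sub>R m))) -` A"
      using r by (simp add: row matrix_vector_mul_assoc T(3))
  next
    fix y assume "T' *v ((1 / r) *\<^sub>R (y - ln (real n) *\<^sub>R m)) \<in> A"
    moreover have "y = r *\<^sub>R ((T' *v ((1 / r) *\<^sub>R (y - ln (real n) *\<^sub>R m))) v* T) + ln (real n) *\<^sub>R m"
      using r by (simp add: row matrix_vector_mul_assoc T(2))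
    ultimately show "y \<in> (\<lambda>a. r *\<^sub>R (a v* T) + ln (real n) *\<^sub>R m) ` A" by blast
  qed simp
  moreover have "space L = UNIV" using sets_eq_imp_space_eq[OF sets] by simp
  ultimately show ?thesis
    unfolding centered_scaled_def distr_def r_def[symmetric] by simp
qed

theorem theorem14:
  fixes N :: "'b measure" and X :: "nat \<Rightarrow> 'b \<Rightarrow> real^'d" and p :: "(real^'d) pmf"
    and M :: "'a measure" and u0 :: "real^'d \<Rightarrow> real"
    and U :: "nat \<Rightarrow> 'a \<Rightarrow> real^'d \<Rightarrow> real" and Z :: "nat \<Rightarrow> 'a \<Rightarrow> real^'d"
    and \<mu> :: "real^'d" and \<Sigma> :: "real^'d^'d"
  assumes "prob_space N"
    and "prob_space.indep_vars N (\<lambda>_. borel) X {1..}"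
    and "\<And>i. i \<ge> 1 \<Longrightarrow> distr N borel (X i) = distr (measure_pmf p) borel (\<lambda>x. x)"
    and "finite (set_pmf p)"
    and "\<mu> = prob_space.expectation N (X 1)"
    and "\<Sigma> = second_moment_matrix N (X 1)"
    and "positive_definite \<Sigma>"
    and "infinite_color_urn M p u0 U Z"
  shows "weakly_converges
    (\<lambda>n. centered_scaled (mean_color_law M (color_set (set_pmf p)) U n) \<mu> (matrix_sqrt \<Sigma>) n)
    std_gaussian"
proof -
  note fin = assms(4)
  interpret infinite_color_urn M p u0 U Z by fact
  have X1: "X 1 \<in> borel_measurable N" 
    using assms(2) unfolding prob_space.indep_vars_def[OF assms(1)] by simp
  note law = assms(3)[OF order_refl]
  have \<mu>: "\<mu> = (\<Sum>b\<in>set_pmf p. pmf p b *\<^sub>R b)"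
    using integral_finite_law[OF X1 law fin, of "\<lambda>x. x"] assms(5) by simp
  define T where "T = matrix_sqrt \<Sigma>"
  have T: "positive_definite T" "T ** T = \<Sigma>"
    using matrix_sqrt_positive_definite[OF assms(7)] by (simp_all add: T_def)
  have symT: "transpose T = T" using T(1) by (simp add: positive_definite_def)
  have "T *v x \<noteq> 0" if "x \<noteq> 0" for x
    using T(1) that by (force simp: positive_definite_def)
  then obtain T' where T'T: "T' ** T = mat 1"
    using matrix_left_invertible_ker[of T] by blast
  then have TT': "T ** T' = mat 1" by (simp add: matrix_left_right_inverse)
  define L where "L n = mean_color_law M (color_set (set_pmf p)) U n" for n
  define g where "g n y = T' *v ((1 / sqrt (ln (real n))) *\<^sub>R (y - ln (real n) *\<^sub>R \<mu>))" for n y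
  have L: "prob_space (L n)" "sets (L n) = sets borel" for n
    unfolding L_def by (rule prob_space_mean_color_law[OF fin]) (simp add: mean_color_law_def)
  have g: "g n \<in> borel_measurable borel" for n
    unfolding g_def[abs_def]
    by (intro borel_measurable_continuous_onI continuous_intros
        bounded_linear.continuous_on[OF matrix_vector_mul_bounded_linear])
  then have gL: "g n \<in> borel_measurable (L n)" for n
    unfolding measurable_cong_sets[OF L(2) refl] .
  have scaled: "centered_scaled (L n) \<mu> T n = distr (L n) borel (g n)" if "n \<ge> 2" for n
    unfolding g_def[abs_def] by (rule centered_scaled_eq_distr[OF L(2) that symT TT' T'T])
  have char_limit: "(\<lambda>n. \<integral>x. iexp (\<theta> \<bullet> x) \<partial>distr (L n) borel (g n)) \<longlonglongrightarrow> (\<integral>x. iexp (\<theta> \<bullet> x) \<partial>std_gaussian)" for \<theta>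
  proof -
    \<comment> \<open>The frequency that the inverse square root attaches to \<open>\<theta>\<close>; its quadratic form under \<open>\<Sigma>\<close> is \<open>(norm \<theta>)\<^sup>2\<close>.\<close>
    define s where "s = T' *v \<theta>"
    have Ts: "T *v s = \<theta>" by (simp add: s_def matrix_vector_mul_assoc TT')
    have "(\<Sum>b\<in>set_pmf p. pmf p b * (s \<bullet> b)\<^sup>2) = s \<bullet> (T *v (T *v s))"
      using second_moment_quadratic_form[OF X1 law fin, of s] T(2) assms(6)
      by (simp add: matrix_vector_mul_assoc)
    also have "\<dots> = (norm \<theta>)\<^sup>2"
      using positive_definite_symmetric[OF T(1), of s "T *v s"] by (simp add: Ts power2_norm_eq_inner)
    finally have Q: "(\<Sum>b\<in>set_pmf p. pmf p b * (s \<bullet> b)\<^sup>2) = (norm \<theta>)\<^sup>2" .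
    have phase: "\<theta> \<bullet> g n y = - (sqrt (ln (real n)) * (s \<bullet> \<mu>)) + ((1 / sqrt (ln (real n))) *\<^sub>R s) \<bullet> y" for n y
    proof -
      have "\<theta> \<bullet> g n y = s \<bullet> (T *v g n y)"
        using positive_definite_symmetric[OF T(1), of s "g n y"] by (simp add: Ts)
      also have "T *v g n y = (1 / sqrt (ln (real n))) *\<^sub>R (y - ln (real n) *\<^sub>R \<mu>)"
        unfolding g_def matrix_vector_mul_assoc TT' by simp
      also have "s \<bullet> \<dots> = (s \<bullet> y) / sqrt (ln (real n)) - (ln (real n) / sqrt (ln (real n))) * (s \<bullet> \<mu>)"
        by (simp add: inner_diff_right diff_divide_distrib)
      also have "ln (real n) / sqrt (ln (real n)) = sqrt (ln (real n))"
        by (cases "n = 0") (auto simp: real_div_sqrt)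
      finally show ?thesis by simp
    qed
    have iexp_g: "iexp (\<theta> \<bullet> g n y) =
        exp (- \<i> * of_real (sqrt (ln (real n)) * (s \<bullet> \<mu>))) * iexp (((1 / sqrt (ln (real n))) *\<^sub>R s) \<bullet> y)" for n y
      by (simp only: phase of_real_add of_real_minus distrib_left exp_add mult_minus_left mult_minus_right)
    have "(\<integral>x. iexp (\<theta> \<bullet> x) \<partial>distr (L n) borel (g n)) =
        exp (- \<i> * of_real (sqrt (ln (real n)) * (s \<bullet> \<mu>))) * mean_char n ((1 / sqrt (ln (real n))) *\<^sub>R s)" for n
    proof -
      have "(\<integral>x. iexp (\<theta> \<bullet> x) \<partial>distr (L n) borel (g n)) = (\<integral>y. iexp (\<theta> \<bullet> g n y) \<partial>L n)"
        by (rule integral_distr[OF gL]) simp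
      also have "\<dots> = exp (- \<i> * of_real (sqrt (ln (real n)) * (s \<bullet> \<mu>))) *
          (\<integral>y. iexp (((1 / sqrt (ln (real n))) *\<^sub>R s) \<bullet> y) \<partial>L n)"
        unfolding iexp_g by (rule integral_mult_right_zero)
      also have "(\<integral>y. iexp (((1 / sqrt (ln (real n))) *\<^sub>R s) \<bullet> y) \<partial>L n) = mean_char n ((1 / sqrt (ln (real n))) *\<^sub>R s)"
        unfolding L_def mean_char_def by (rule integral_mean_color_law[OF fin]) simp
      finally show ?thesis .
    qed
    moreover have "(\<lambda>n. exp (- \<i> * of_real (sqrt (ln (real n)) * (s \<bullet> \<mu>))) * mean_char n ((1 / sqrt (ln (real n))) *\<^sub>R s))
        \<longlonglongrightarrow> of_real (exp (- (norm \<theta>)\<^sup>2 / 2))"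
      unfolding \<mu> Q[symmetric]
    proof (rule harmonic_product_char_limit[where p="pmf p" and B="set_pmf p" and \<phi>=mean_char])
      show "sum (pmf p) (set_pmf p) = 1" by (rule sum_pmf_eq_1[OF fin]) simp
    qed (rule fin pmf_nonneg mean_char_prod[OF fin] isCont_mean_char mean_char_0_0)+
    ultimately show ?thesis by (simp add: char_std_gaussian)
  qed
  have "weakly_converges (\<lambda>n. distr (L n) borel (g n)) (std_gaussian :: (real^'d) measure)"
  proof (rule levy_continuity_euclidean)
    show "prob_space (distr (L n) borel (g n))" for n
      by (rule prob_space.prob_space_distr[OF L(1) gL])
    show "sets (std_gaussian :: (real^'d) measure) = sets borel" by (simp add: std_gaussian_def)
  qed (simp_all add: prob_space_std_gaussian char_limit)
  then show ?thesis
    unfolding weakly_converges_def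
  proof (elim all_forward imp_forward)
    fix f :: "real^'d \<Rightarrow> real"
    assume lim: "(\<lambda>n. \<integral>x. f x \<partial>distr (L n) borel (g n)) \<longlonglongrightarrow> (\<integral>x. f x \<partial>std_gaussian)"
    \<comment> \<open>For \<open>n < 2\<close> the scaling factor \<open>sqrt (ln n)\<close> degenerates, so the two sequences agree only eventually.\<close>
    have "\<forall>\<^sub>F n in sequentially. (\<integral>x. f x \<partial>distr (L n) borel (g n)) =
        (\<integral>x. f x \<partial>centered_scaled (L n) \<mu> T n)"
      using eventually_ge_at_top[of 2] by eventually_elim (simp add: scaled)
    with lim show "(\<lambda>n. \<integral>x. f x \<partial>centered_scaled (mean_color_law M (color_set (set_pmf p)) U n) \<mu> (matrix_sqrt \<Sigma>) n)
        \<longlonglongrightarrow> (\<integral>x. f x \<partial>std_gaussian)"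
      unfolding L_def[symmetric] T_def[symmetric] by (rule Lim_transform_eventually)
  qed
qed

end
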